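(* Let $\varphi = c g + d\,\overline{g}$, where $g \in H^{\infty}(\mathbb{D})$ and $c, d \in \mathbb{C}$ are constants. Then the following are equivalent: (1) The Toeplitz operator $T_{\varphi}$ is invertible on the Bergman space $L^2_a(\mathbb{D})$. (2) There exists $\delta > 0$ such that $|\varphi(z)| \geq \delta$ for all $z \in \mathbb{D}$, i.e., $\inf_{z \in \mathbb{D}} |\widetilde{\varphi}(z)| = \inf_{z \in \mathbb{D}} |\varphi(z)| > 0$, where $\widetilde{\varphi}$ is the Berezin transform of $\varphi$.
   Context: $\mathbb{D} = \{z \in \mathbb{C} : |z| < 1\}$ is the open unit disc, and $dA$ is the normalized Lebesgue area measure on $\mathbb{D}$ (so $A(\mathbb{D}) = 1$). $L^2(\mathbb{D}, dA)$ is the complex Hilbert space of square integrable functions with inner product $\langle f, h\rangle = \int_{\mathbb{D}} f \overline{h}\, dA$. The Bergman space $L^2_a(\mathbb{D})$ is the closed subspace of $L^2(\mathbb{D}, dA)$ consisting of analytic functions; it is a reproducing kernel Hilbert space with kernel $K_z(w) = \frac{1}{(1-\bar z w)^2}$, $z, w \in \mathbb{D}$. $H^{\infty}(\mathbb{D})$ is the algebra of bounded analytic functions on $\mathbb{D}$, and $L^\infty(\mathbb{D})$ is the space of essentially bounded functions on $\mathbb{D}$. For $\varphi \in L^{\infty}(\mathbb{D})$, the Toeplitz operator $T_{\varphi} : L^2_a(\mathbb{D}) \to L^2_a(\mathbb{D})$ is defined by $T_{\varphi} f = P(\varphi f)$, where $P$ is the orthogonal projection of $L^2(\mathbb{D},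 dA)$ onto $L^2_a(\mathbb{D})$. The Berezin transform of $\varphi$ is $\widetilde{\varphi}(z) = \langle T_{\varphi} k_z, k_z\rangle = \int_{\mathbb{D}} \varphi(w) \frac{(1-|z|^2)^2}{|1 - \bar z w|^4}\, dA(w)$ for $z \in \mathbb{D}$, where $k_z = K_z/\|K_z\|$. Invertible means invertible as a bounded linear operator (bounded two-sided inverse). *)

theory Defs
  imports "HOL-Analysis.Analysis"
begin

abbreviation unit_disc :: "complex set" where
  "unit_disc \<equiv> ball 0 1"

definition area :: "complex measure" where
  "area = density (lebesgue_on unit_disc) (\<lambda>_. ennreal (1 / pi))"

lemma space_area: "space area = unit_disc"
  by (simp add: area_def)

lemma emeasure_area_unit_disc: "emeasure area unit_disc = 1"
proof -
  have "emeasure (lebesgue_on unit_disc) unit_disc = ennreal pi"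
    by (simp add: emeasure_restrict_space emeasure_ball unit_ball_vol_2)
  moreover have "unit_disc \<in> sets (lebesgue_on unit_disc)"
    by (simp add: sets_restrict_space_iff)
  ultimately show ?thesis
    by (simp add: area_def emeasure_density_const flip: ennreal_mult)
qed

definition L2 :: "(complex \<Rightarrow> complex) set" where
  "L2 = {f. f \<in> borel_measurable area \<and> integrable area (\<lambda>z. (cmod (f z))\<^sup>2)}"

definition L2_inner :: "(complex \<Rightarrow> complex) \<Rightarrow> (complex \<Rightarrow> complex) \<Rightarrow> complex" where
  "L2_inner f h = (\<integral>z. f z * cnj (h z) \<partial>area)"

definition L2_norm :: "(complex \<Rightarrow> complex) \<Rightarrow> real" where
  "L2_norm f = sqrt (\<integral>z. (cmod (f z))\<^sup>2 \<partial>area)"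

text \<open>
  Elements of the Bergman space are functions on the disc, represented by their extension by
  zero to all of \<open>complex\<close>. An analytic class in \<open>L2\<close> has exactly one analytic representative
  on the disc, so with this convention equality in the Bergman space is equality of functions.
\<close>

definition bergman :: "(complex \<Rightarrow> complex) set" where
  "bergman = {f \<in> L2. f holomorphic_on unit_disc \<and> (\<forall>z. z \<notin> unit_disc \<longrightarrow> f z = 0)}"

definition H_infinity :: "(complex \<Rightarrow> complex) set" where
  "H_infinity = {g. g holomorphic_on unit_disc \<and> bounded (g ` unit_disc)}"

text \<open>
  Orthogonal projection of \<open>L2\<close> onto the closed subspace \<open>bergman\<close>: the unique element of the
  subspace whose difference from \<open>h\<close> is orthogonal to the subspace. Meaningful for \<open>h \<in> L2\<close> only.
\<close>

definition bergman_proj :: "(complex \<Rightarrow> complex) \<Rightarrow> complex \<Rightarrow> complex" where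
  "bergman_proj h =
    (THE f. f \<in> bergman \<and> (\<forall>u\<in>bergman. L2_inner (\<lambda>z. h z - f z) u = 0))"

text \<open>
  The symbol \<open>\<phi>\<close> is meant to be essentially bounded on the disc; its values elsewhere are irrelevant.
\<close>

definition toeplitz :: "(complex \<Rightarrow> complex) \<Rightarrow> (complex \<Rightarrow> complex) \<Rightarrow> complex \<Rightarrow> complex" where
  "toeplitz \<phi> f = bergman_proj (\<lambda>z. \<phi> z * f z)"

definition bergman_kernel :: "complex \<Rightarrow> complex \<Rightarrow> complex" where
  "bergman_kernel z w = (if w \<in> unit_disc then 1 / (1 - cnj z * w)\<^sup>2 else 0)"

definition normalized_kernel :: "complex \<Rightarrow> complex \<Rightarrow> complex" where
  "normalized_kernel z w = bergman_kernel z w / of_real (L2_norm (bergman_kernel z))"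

definition berezin :: "(complex \<Rightarrow> complex) \<Rightarrow> complex \<Rightarrow> complex" where
  "berezin \<phi> z = L2_inner (toeplitz \<phi> (normalized_kernel z)) (normalized_kernel z)"

definition bergman_bounded_operator ::
  "((complex \<Rightarrow> complex) \<Rightarrow> complex \<Rightarrow> complex) \<Rightarrow> bool" where
  "bergman_bounded_operator T \<longleftrightarrow>
    (\<forall>f\<in>bergman. T f \<in> bergman) \<and>
    (\<forall>f\<in>bergman. \<forall>h\<in>bergman. T (\<lambda>z. f z + h z) = (\<lambda>z. T f z + T h z)) \<and>
    (\<forall>a. \<forall>f\<in>bergman. T (\<lambda>z. a * f z) = (\<lambda>z. a * T f z)) \<and>
    (\<exists>C. \<forall>f\<in>bergman. L2_norm (T f) \<le> C * L2_norm f)"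

definition bergman_invertible ::
  "((complex \<Rightarrow> complex) \<Rightarrow> complex \<Rightarrow> complex) \<Rightarrow> bool" where
  "bergman_invertible T \<longleftrightarrow>
    bergman_bounded_operator T \<and>
    (\<exists>S. bergman_bounded_operator S \<and> (\<forall>f\<in>bergman. S (T f) = f \<and> T (S f) = f))"

end

theory Submission
  imports Defs "HOL-Complex_Analysis.Cauchy_Integral_Formula"
begin

text \<open>
  Let \<open>\<phi> = c g + d g\<^sup>*\<close>, where \<open>g\<^sup>*\<close> is the complex conjugate of \<open>g\<close>. Two product rules hold for Toeplitz
  operators: an analytic factor of the symbol can be split off on the right and a coanalytic one on the
  left (\<open>toeplitz_mult_analytic\<close>, \<open>toeplitz_mult_coanalytic\<close>). Moreover, a Toeplitz operator is invertible
  when its symbol stays within a distance \<open>q < cmod a\<close> of a constant \<open>a\<close>, because it is then a small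
  perturbation of \<open>a\<close> times the identity (\<open>toeplitz_near_constant_invertible\<close>).

  If \<open>cmod d < cmod c\<close>, write \<open>\<phi> = (c + d g\<^sup>* / g) g\<close>. The quotient \<open>g\<^sup>* / g\<close> has modulus at most one, so the
  first factor is close to the constant \<open>c\<close>, and the Toeplitz operator of \<open>\<phi>\<close> is invertible exactly when
  multiplication by \<open>g\<close> is. If \<open>cmod c < cmod d\<close>, the factorization \<open>\<phi> = g\<^sup>* (d + c g / g\<^sup>*)\<close> reduces the question
  to the symbol \<open>g\<^sup>*\<close> in the same way. Both are invertible exactly when \<open>g\<close> is bounded away from zero, as
  the reproducing kernels show, and this is equivalent to \<open>\<phi>\<close> being bounded away from zero.

  If the moduli agree and are not zero, \<open>\<phi>\<close> is a constant times a bounded real harmonic function. If it is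
  bounded away from zero, it has constant sign, its values lie in a half-line away from zero, and it is
  close to a constant again. Conversely, suppose that \<open>\<phi>\<close> is not bounded away from zero. The equation
  \<open>c w + d w\<^sup>* = 0\<close> defines a line that meets the closure of the range of \<open>g\<close>, hence also its frontier, say
  in \<open>\<mu>\<close>. A frontier point of the spectrum of multiplication by \<open>g\<close> is an approximate eigenvalue
  (\<open>approximate_eigenvector_at_frontier\<close>), and since \<open>\<phi> = c (g - \<mu>) + d (g - \<mu>)\<^sup>*\<close>, an approximate eigenvector
  is almost annihilated by the Toeplitz operator of \<open>\<phi>\<close>, which is therefore not invertible.
  For \<open>c = d = 0\<close> the operator is zero, which is not invertible either.

  The part about the Berezin transform holds because the transform fixes \<open>\<phi>\<close> (\<open>berezin_combination\<close>).

  The Hilbert space facts behind this come from the reproducing property (\<open>bergman_reproducing\<close>), which is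
  proved by integrating power series: rotation invariance makes monomials orthogonal, and the squared
  modulus is uniformly distributed. It makes point evaluations bounded, hence the Bergman space complete
  and the orthogonal projection well defined.
\<close>

section \<open>Area measure: rotations, radial functions and monomials\<close>

text \<open>
  The image measure \<open>\<mu>\<close> is translation invariant, and such a measure is a multiple of Lebesgue
  measure: for the unit ball \<open>A\<close> and a Borel set \<open>B\<close>, evaluating the double integral of
  \<open>I (f x) * J (f x + y)\<close>, where \<open>I\<close> and \<open>J\<close> are the indicators of \<open>A\<close> and \<open>B\<close>, in both orders
  gives \<open>\<mu>(A) \<lambda>(B) = \<mu>(B) \<lambda>(A)\<close>. Since \<open>f\<close> preserves the unit ball, the factor is one.
\<close>
lemma lborel_orthogonal_invariant:
  fixes f :: "'a::euclidean_space \<Rightarrow> 'a"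
  assumes f: "orthogonal_transformation f"
  shows "distr lborel borel f = lborel"
proof (rule measure_eqI)
  have lin: "linear f" and nrm: "\<And>x. norm (f x) = norm x"
    using f by (auto simp: orthogonal_transformation)
  have [measurable]: "f \<in> borel_measurable borel"
    by (intro borel_measurable_continuous_onI linear_continuous_on) (use lin linear_conv_bounded_linear in auto)
  let ?A = "ball (0::'a) 1"
  define I :: "'a \<Rightarrow> ennreal" where "I = indicator ?A"
  have [measurable]: "I \<in> borel_measurable borel"
    by (simp add: I_def borel_measurable_indicator)
  have ballv: "emeasure lborel (ball x (1::real)) = emeasure lborel ?A" for x :: 'a
    by (simp add: emeasure_ball)
  have fin: "emeasure lborel ?A \<noteq> \<infinity>" "emeasure lborel ?A \<noteq> 0"
    using unit_ball_vol_pos[of "real DIM('a)"] by (auto simp: emeasure_ball simp del: unit_ball_vol_pos)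
  show "sets (distr lborel borel f) = sets lborel" by simp
  fix B assume "B \<in> sets (distr lborel borel f)"
  then have [measurable]: "B \<in> sets borel" by simp
  define J :: "'a \<Rightarrow> ennreal" where "J = indicator B"
  have [measurable]: "J \<in> borel_measurable borel"
    by (simp add: J_def borel_measurable_indicator)
  have IA: "(\<integral>\<^sup>+ x. I x \<partial>lborel) = emeasure lborel ?A"
    and JB: "(\<integral>\<^sup>+ x. J x \<partial>lborel) = emeasure lborel B"
    by (simp_all add: I_def J_def)
  have shift: "(\<integral>\<^sup>+ y. h (a + y) \<partial>lborel) = (\<integral>\<^sup>+ y. h y \<partial>lborel)"
    if [measurable]: "h \<in> borel_measurable borel" for h :: "'a \<Rightarrow> ennreal" and a
    by (subst (2) lborel_distr_plus[of a, symmetric]) (simp add: nn_integral_distr)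
  have "emeasure lborel ?A * emeasure lborel B = (\<integral>\<^sup>+ x. I (f x) * emeasure lborel B \<partial>lborel)"
  proof -
    have "(\<integral>\<^sup>+ x. I (f x) \<partial>lborel) = (\<integral>\<^sup>+ x. I x \<partial>lborel)"
      by (rule nn_integral_cong) (simp add: nrm I_def indicator_def)
    moreover have "(\<integral>\<^sup>+ x. I (f x) * emeasure lborel B \<partial>lborel)
        = (\<integral>\<^sup>+ x. I (f x) \<partial>lborel) * emeasure lborel B"
      by (rule nn_integral_multc) measurable
    ultimately show ?thesis
      by (simp add: IA)
  qed
  also have "\<dots> = (\<integral>\<^sup>+ x. I (f x) * (\<integral>\<^sup>+ y. J (f x + y) \<partial>lborel) \<partial>lborel)"
    by (simp add: shift JB)
  also have "\<dots> = (\<integral>\<^sup>+ x. (\<integral>\<^sup>+ y. I (f x) * J (f x + y) \<partial>lborel) \<partial>lborel)"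
    by (simp add: nn_integral_cmult)
  also have "\<dots> = (\<integral>\<^sup>+ y. (\<integral>\<^sup>+ x. I (f x) * J (f x + y) \<partial>lborel) \<partial>lborel)"
    by (rule lborel_pair.Fubini') measurable
  also have "\<dots> = (\<integral>\<^sup>+ y. (\<integral>\<^sup>+ x. I (f x - y) * J (f x) \<partial>lborel) \<partial>lborel)"
  proof (rule nn_integral_cong)
    fix y :: 'a
    obtain u where u: "f u = y"
      using orthogonal_transformation_surj[OF f] by (metis surjD)
    have "(\<integral>\<^sup>+ x. I (f x - y) * J (f x) \<partial>lborel) = (\<integral>\<^sup>+ x. I (f (u + x) - y) * J (f (u + x)) \<partial>lborel)"
      by (rule shift[symmetric]) measurable
    then show "(\<integral>\<^sup>+ x. I (f x) * J (f x + y) \<partial>lborel) = (\<integral>\<^sup>+ x. I (f x - y) * J (f x) \<partial>lborel)"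
      by (simp add: linear_add[OF lin] u add.commute)
  qed
  also have "\<dots> = (\<integral>\<^sup>+ x. (\<integral>\<^sup>+ y. I (f x - y) * J (f x) \<partial>lborel) \<partial>lborel)"
    by (rule lborel_pair.Fubini') measurable
  also have "\<dots> = (\<integral>\<^sup>+ x. (\<integral>\<^sup>+ y. indicator (ball (f x) 1) y * J (f x) \<partial>lborel) \<partial>lborel)"
    by (intro nn_integral_cong) (simp add: I_def indicator_def dist_norm norm_minus_commute)
  also have "\<dots> = (\<integral>\<^sup>+ x. emeasure lborel ?A * J (f x) \<partial>lborel)"
  proof (rule nn_integral_cong)
    fix x
    have "(\<integral>\<^sup>+ y. indicator (ball (f x) 1) y * J (f x) \<partial>lborel) = emeasure lborel (ball (f x) 1) * J (f x)"
      by (subst nn_integral_multc) (auto simp: borel_measurable_indicator)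
    then show "(\<integral>\<^sup>+ y. indicator (ball (f x) 1) y * J (f x) \<partial>lborel) = emeasure lborel ?A * J (f x)"
      by (simp only: ballv[of "f x"])
  qed
  also have "\<dots> = emeasure lborel ?A * (\<integral>\<^sup>+ x. J x \<partial>distr lborel borel f)"
    by (simp add: nn_integral_cmult nn_integral_distr)
  also have "\<dots> = emeasure lborel ?A * emeasure (distr lborel borel f) B"
    by (simp add: J_def)
  finally show "emeasure (distr lborel borel f) B = emeasure lborel B"
    using fin by (metis ennreal_mult_cancel_left infinity_ennreal_def)
qed

lemma sets_area: "sets area = sets (lebesgue_on unit_disc)"
  by (simp add: area_def)

lemma prob_area: "emeasure area (space area) = 1"
  by (simp add: space_area emeasure_area_unit_disc)

interpretation area: finite_measure area
  by standard (simp add: prob_area)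

lemma borel_measurable_area:
  assumes "continuous_on unit_disc f"
  shows "f \<in> borel_measurable area"
  using continuous_imp_measurable_on_sets_lebesgue[OF assms, of ] measurable_cong_sets[OF sets_area refl]
  by auto

lemma borel_measurable_area_borel: "f \<in> borel_measurable borel \<Longrightarrow> f \<in> borel_measurable area"
  unfolding measurable_cong_sets[OF sets_area refl]
  by (intro measurable_restrict_space1 measurable_completion) simp

lemma indicator_ball_measurable_area [measurable]:
  "(indicator (ball 0 r) :: complex \<Rightarrow> real) \<in> borel_measurable area"
  by (intro borel_measurable_area_borel borel_measurable_indicator) simp

lemma nn_integral_area:
  assumes [measurable]: "f \<in> borel_measurable borel"
  shows "(\<integral>\<^sup>+ z. f z \<partial>area) = ennreal (1 / pi) * (\<integral>\<^sup>+ z\<in>unit_disc. f z \<partial>lborel)"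
proof -
  have m: "f \<in> borel_measurable lebesgue" "(\<lambda>z. f z) \<in> borel_measurable (lebesgue_on unit_disc)"
    using assms by (auto intro!: measurable_restrict_space1 measurable_completion)
  have "(\<integral>\<^sup>+ z. f z \<partial>area) = ennreal (1 / pi) * (\<integral>\<^sup>+ z. f z \<partial>lebesgue_on unit_disc)"
    unfolding area_def using m by (simp add: nn_integral_density nn_integral_cmult)
  also have "(\<integral>\<^sup>+ z. f z \<partial>lebesgue_on unit_disc) = (\<integral>\<^sup>+ z\<in>unit_disc. f z \<partial>lebesgue)"
    by (rule nn_integral_restrict_space) auto
  also have "\<dots> = (\<integral>\<^sup>+ z\<in>unit_disc. f z \<partial>lborel)"
    by (rule nn_integral_completion)
  finally show ?thesis .
qed

lemma integral_area:
  fixes f :: "complex \<Rightarrow> complex"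
  assumes [measurable]: "f \<in> borel_measurable borel"
  shows "(\<integral>z. f z \<partial>area) = (\<integral>z. indicator unit_disc z *\<^sub>R f z \<partial>lborel) / pi"
proof -
  have m: "f \<in> borel_measurable lebesgue" "(\<lambda>z. f z) \<in> borel_measurable (lebesgue_on unit_disc)"
    using assms by (auto intro!: measurable_restrict_space1 measurable_completion)
  have "(\<integral>z. f z \<partial>area) = (\<integral>z. (1 / pi) *\<^sub>R f z \<partial>lebesgue_on unit_disc)"
    unfolding area_def using m by (subst integral_density) auto
  also have "\<dots> = (1 / pi) *\<^sub>R (\<integral>z. f z \<partial>lebesgue_on unit_disc)"
    by (rule integral_scaleR_right) 
  also have "(\<integral>z. f z \<partial>lebesgue_on unit_disc) = (\<integral>z. indicator unit_disc z *\<^sub>R f z \<partial>lebesgue)"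
    by (rule integral_restrict_space) auto
  also have "\<dots> = (\<integral>z. indicator unit_disc z *\<^sub>R f z \<partial>lborel)"
    by (rule integral_completion) (simp add: borel_measurable_scaleR borel_measurable_indicator assms)
  finally show ?thesis by (simp add: scaleR_conv_of_real)
qed

lemma cnj_measurable [measurable]: "cnj \<in> borel_measurable borel"
  by (intro borel_measurable_continuous_onI continuous_intros)

text \<open>
  The integral is multiplied by \<open>\<omega> ^ m * cnj \<omega> ^ n\<close> under the substitution \<open>w \<mapsto> \<omega> w\<close>, so it
  vanishes as soon as some rotation makes this factor different from one.
\<close>
lemma area_monomials_orthogonal:
  assumes "m \<noteq> n"
  shows "(\<integral>w. indicator (ball 0 r) w *\<^sub>R (w ^ m * cnj w ^ n) \<partial>area) = 0"
proof -
  define k where "k = int m - int n"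
  have "k \<noteq> 0" using assms by (simp add: k_def)
  \<comment> \<open>A rotation that multiplies the integrand by \<open>-1\<close>.\<close>
  define \<omega> where "\<omega> = cis (pi / k)"
  have \<omega>: "\<omega> ^ m * cnj \<omega> ^ n = -1" "cmod \<omega> = 1"
  proof -
    have "\<omega> ^ m * cnj \<omega> ^ n = cis (real m * (pi / k)) * cis (real n * (- (pi / k)))"
      by (simp only: \<omega>_def cis_cnj Complex.DeMoivre)
    also have "\<dots> = cis (pi / k * k)"
    proof -
      have "real m * x + real n * (- x) = x * k" for x
        by (simp add: k_def algebra_simps)
      then show ?thesis by (simp only: cis_mult)
    qed
    finally show "\<omega> ^ m * cnj \<omega> ^ n = -1"
      using \<open>k \<noteq> 0\<close> by simp
  qed (simp add: \<omega>_def)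
  have rot: "orthogonal_transformation ((*) \<omega>)"
    unfolding orthogonal_transformation
    by (auto simp: \<omega> norm_mult intro!: bounded_linear.linear bounded_linear_mult_right)
  let ?F = "\<lambda>w. indicator unit_disc w *\<^sub>R indicator (ball 0 r) w *\<^sub>R (w ^ m * cnj w ^ n) :: complex"
  have [measurable]: "(\<lambda>w. w ^ m * cnj w ^ n) \<in> borel_measurable borel"
    by (intro borel_measurable_continuous_onI continuous_intros)
  have [measurable]: "?F \<in> borel_measurable borel"
    by (intro borel_measurable_scaleR borel_measurable_indicator) auto
  have [measurable]: "((*) \<omega>) \<in> borel_measurable borel" by simp
  have "(\<integral>w. ?F w \<partial>lborel) = (\<integral>w. ?F w \<partial>distr lborel borel ((*) \<omega>))"
    by (simp add: lborel_orthogonal_invariant[OF rot])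
  also have "\<dots> = (\<integral>w. ?F (\<omega> * w) \<partial>lborel)"
    by (rule integral_distr, simp, fact)
  also have "\<dots> = (\<integral>w. - ?F w \<partial>lborel)"
  proof (rule Bochner_Integration.integral_cong[OF refl])
    fix w
    have "(\<omega> * w) ^ m * cnj (\<omega> * w) ^ n = (\<omega> ^ m * cnj \<omega> ^ n) * (w ^ m * cnj w ^ n)"
      by (simp add: power_mult_distrib)
    then show "?F (\<omega> * w) = - ?F w"
      by (simp add: \<omega> indicator_def norm_mult)
  qed
  also have "\<dots> = - (\<integral>w. ?F w \<partial>lborel)"
    by simp
  finally have "(\<integral>w. ?F w \<partial>lborel) = 0"
    by simp
  moreover have "(\<lambda>w. indicator (ball 0 r) w *\<^sub>R (w ^ m * cnj w ^ n)) \<in> borel_measurable borel"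
    by (intro borel_measurable_scaleR borel_measurable_indicator) auto
  ultimately show ?thesis
    by (simp add: integral_area)
qed

text \<open>
  The squared modulus is uniformly distributed on the unit interval, because a disc of radius
  \<open>r\<close> has normalized area \<open>r\<^sup>2\<close>. This replaces polar coordinates for radial integrands.
\<close>
lemma distr_area_norm_square:
  "distr area borel (\<lambda>w. (cmod w)\<^sup>2) = density lborel (indicator {0..1})"
proof (rule measure_eqI_lessThan)
  let ?N = "\<lambda>w::complex. (cmod w)\<^sup>2"
  have [measurable]: "?N \<in> borel_measurable area"
    by (intro borel_measurable_area continuous_intros)
  have *: "emeasure (distr area borel ?N) {x<..} = ennreal (1 - max 0 (min 1 x))" for x
  proof -
    have "emeasure (distr area borel ?N) {x<..} = (\<integral>\<^sup>+ z. indicator {x<..} (?N z) \<partial>area)"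
      by (simp add: nn_integral_distr flip: nn_integral_indicator)
    also have "\<dots> = ennreal (1 / pi) * (\<integral>\<^sup>+ z\<in>unit_disc. indicator {x<..} (?N z) \<partial>lborel)"
      by (rule nn_integral_area) auto
    also have "(\<integral>\<^sup>+ z\<in>unit_disc. indicator {x<..} (?N z) \<partial>lborel)
        = emeasure lborel {z::complex. cmod z < 1 \<and> x < (cmod z)\<^sup>2}"
    proof -
      have "(\<integral>\<^sup>+ z\<in>unit_disc. indicator {x<..} (?N z) \<partial>lborel)
          = (\<integral>\<^sup>+ z. indicator {z::complex. cmod z < 1 \<and> x < (cmod z)\<^sup>2} z \<partial>lborel)"
        by (rule nn_integral_cong) (auto simp: indicator_def)
      then show ?thesis
        by (simp add: nn_integral_indicator)
    qed
    also have "\<dots> = ennreal (pi * (1 - max 0 (min 1 x)))"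
    proof -
      consider "x < 0" | "0 \<le> x" "x < 1" | "1 \<le> x" by linarith
      then show ?thesis
      proof cases
        case 1
        then have "{z::complex. cmod z < 1 \<and> x < (cmod z)\<^sup>2} = ball 0 1"
          by (auto intro: less_le_trans)
        with 1 show ?thesis
          by (simp add: emeasure_ball unit_ball_vol_2)
      next
        case 2
        have sq: "x < (cmod z)\<^sup>2 \<longleftrightarrow> sqrt x < cmod z" for z
          using real_sqrt_less_iff[of x "(cmod z)\<^sup>2"] by simp
        have eq: "{z::complex. cmod z < 1 \<and> x < (cmod z)\<^sup>2} = ball 0 1 - cball 0 (sqrt x)"
          by (intro set_eqI) (simp only: sq mem_Collect_eq Diff_iff mem_ball mem_cball dist_0_norm not_le)
        have sub: "cball (0::complex) (sqrt x) \<subseteq> ball 0 1"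
          using 2 by (simp add: cball_subset_ball_iff)
        have c: "emeasure lborel (cball (0::complex) (sqrt x)) = ennreal (pi * x)"
          using 2 by (simp add: emeasure_cball unit_ball_vol_2)
        have b: "emeasure lborel (ball (0::complex) 1) = ennreal pi"
          by (simp add: emeasure_ball unit_ball_vol_2)
        have "emeasure lborel (ball (0::complex) 1 - cball 0 (sqrt x)) = ennreal pi - ennreal (pi * x)"
          by (subst emeasure_Diff) (use sub in \<open>simp_all add: b c\<close>)
        also have "\<dots> = ennreal (pi - pi * x)"
          using 2 by (simp add: ennreal_minus)
        also have "pi - pi * x = pi * (1 - max 0 (min 1 x))"
          using 2 by (simp add: algebra_simps)
        finally show ?thesis
          unfolding eq .
      next
        case 3
        have "\<not> (cmod z < 1 \<and> x < (cmod z)\<^sup>2)" for z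
          using 3 power_le_one[of "cmod z" 2] by auto
        then have "{z::complex. cmod z < 1 \<and> x < (cmod z)\<^sup>2} = {}"
          by blast
        then show ?thesis
          using 3 by (simp only: emeasure_empty) simp
      qed
    qed
    finally show ?thesis
      by (simp flip: ennreal_mult'')
  qed
  show "emeasure (distr area borel ?N) {x<..} < \<infinity>" for x
    by (simp add: *)
  show "emeasure (distr area borel ?N) {x<..} = emeasure (density lborel (indicator {0..1})) {x<..}" for x
  proof -
    have "emeasure (density lborel (indicator {0..1})) {x<..} = emeasure lborel ({0..1} \<inter> {x<..})"
      by (simp add: emeasure_density indicator_inter_arith[symmetric])
    also have "{0..1} \<inter> {x<..} = (if x < 0 then {0..1} else {x<..1})"
      by auto
    finally show ?thesis
      by (auto simp: * max_def min_def)
  qed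
qed auto

text \<open>
  Restricting to the disc of radius \<open>r\<close> keeps power series uniformly convergent; the price is the
  factor \<open>r ^ (2 * n + 2)\<close>.
\<close>
lemma area_monomial_norm:
  assumes "0 \<le> r" "r \<le> 1"
  shows "(\<integral>w. indicator (ball 0 r) w *\<^sub>R (w ^ n * cnj w ^ n) \<partial>area) = of_real (r ^ (2 * n + 2) / (n + 1))"
proof -
  let ?h = "\<lambda>s::real. indicator {..<r\<^sup>2} s * s ^ n"
  have [measurable]: "(\<lambda>w. (cmod w)\<^sup>2) \<in> borel_measurable area"
    by (intro borel_measurable_area continuous_intros)
  have r: "r\<^sup>2 \<le> 1" using assms by (simp add: power_le_one)
  have "(\<integral>w. indicator (ball 0 r) w *\<^sub>R (w ^ n * cnj w ^ n) \<partial>area)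
      = (\<integral>w. of_real (?h ((cmod w)\<^sup>2)) \<partial>area)"
  proof (rule Bochner_Integration.integral_cong[OF refl])
    fix w
    have "w ^ n * cnj w ^ n = (w * cnj w) ^ n"
      by (simp only: power_mult_distrib)
    then have "w ^ n * cnj w ^ n = of_real (((cmod w)\<^sup>2) ^ n)"
      by (simp only: complex_norm_square[symmetric] of_real_power)
    moreover have "cmod w < r \<longleftrightarrow> (cmod w)\<^sup>2 < r\<^sup>2"
      using power_mono_iff[of r "cmod w" 2] assms(1) by (metis norm_ge_zero not_le zero_less_numeral)
    ultimately show "indicator (ball 0 r) w *\<^sub>R (w ^ n * cnj w ^ n) = of_real (?h ((cmod w)\<^sup>2))"
      by (simp add: indicator_def)
  qed
  also have "\<dots> = of_real (\<integral>w. ?h ((cmod w)\<^sup>2) \<partial>area)"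
    by (rule integral_complex_of_real)
  also have "(\<integral>w. ?h ((cmod w)\<^sup>2) \<partial>area) = (\<integral>s. ?h s \<partial>distr area borel (\<lambda>w. (cmod w)\<^sup>2))"
    by (subst integral_distr) auto
  also have "\<dots> = (\<integral>s. indicator {0..1} s * ?h s \<partial>lborel)"
  proof -
    have "density lborel (indicator {0..1}) = density lborel (\<lambda>s::real. ennreal (indicator {0..1} s))"
      by (simp add: ennreal_indicator)
    then show ?thesis
      unfolding distr_area_norm_square by (simp add: integral_density)
  qed
  also have "\<dots> = (\<integral>s. s ^ n * indicator {0..r\<^sup>2} s \<partial>lborel)"
    using r AE_lborel_singleton[of "r\<^sup>2"]
    by (intro integral_cong_AE) (auto simp: indicator_def elim!: eventually_mono)
  also have "\<dots> = ((r\<^sup>2) ^ Suc n - 0 ^ Suc n) / Suc n"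
    by (rule integral_power) simp
  also have "\<dots> = r ^ (2 * n + 2) / (n + 1)"
  proof -
    have "2 * n + 2 = 2 * Suc n" by simp
    then show ?thesis
      by (simp only: power_mult) simp
  qed
  finally show ?thesis .
qed

section \<open>The semi-inner product of square-integrable functions\<close>

lemma L2_measurable: "f \<in> L2 \<Longrightarrow> f \<in> borel_measurable area"
  by (simp add: L2_def)

lemma L2_square_integrable: "f \<in> L2 \<Longrightarrow> integrable area (\<lambda>z. (cmod (f z))\<^sup>2)"
  by (simp add: L2_def)

lemma L2_inner_integrable:
  assumes f: "f \<in> L2" and h: "h \<in> L2"
  shows "integrable area (\<lambda>z. f z * cnj (h z))"
proof (rule Bochner_Integration.integrable_bound)
  show "integrable area (\<lambda>z. (cmod (f z))\<^sup>2 + (cmod (h z))\<^sup>2)"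
    using f h by (intro Bochner_Integration.integrable_add L2_square_integrable)
  show "(\<lambda>z. f z * cnj (h z)) \<in> borel_measurable area"
    using L2_measurable[OF f] L2_measurable[OF h] by measurable
  have "a * b \<le> a\<^sup>2 + b\<^sup>2" if "0 \<le> a" "0 \<le> b" for a b :: real
    using sum_squares_bound[of a b] mult_nonneg_nonneg[OF that] by linarith
  then show "AE z in area. norm (f z * cnj (h z)) \<le> norm ((cmod (f z))\<^sup>2 + (cmod (h z))\<^sup>2)"
    by (simp add: norm_mult)
qed

lemma L2_mult_bounded:
  assumes [measurable]: "\<psi> \<in> borel_measurable area"
    and bd: "\<And>z. z \<in> unit_disc \<Longrightarrow> cmod (\<psi> z) \<le> M" and f: "f \<in> L2"
  shows "(\<lambda>z. \<psi> z * f z) \<in> L2" and "L2_norm (\<lambda>z. \<psi> z * f z) \<le> M * L2_norm f"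
proof -
  have "cmod (\<psi> 0) \<le> M" by (rule bd) simp
  then have M: "0 \<le> M" by (meson norm_ge_zero order_trans)
  note [measurable] = L2_measurable[OF f]
  have pt: "(cmod (\<psi> z * f z))\<^sup>2 \<le> M\<^sup>2 * (cmod (f z))\<^sup>2" if "z \<in> space area" for z
    using that bd[of z] by (auto simp: norm_mult space_area power_mult_distrib intro!: mult_right_mono power_mono)
  have int: "integrable area (\<lambda>z. M\<^sup>2 * (cmod (f z))\<^sup>2)"
    using L2_square_integrable[OF f] by simp
  have int': "integrable area (\<lambda>z. (cmod (\<psi> z * f z))\<^sup>2)"
    by (rule Bochner_Integration.integrable_bound[OF int]) (auto intro!: AE_I2 dest: pt)
  then show "(\<lambda>z. \<psi> z * f z) \<in> L2"
    by (simp add: L2_def)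
  have "(\<integral>z. (cmod (\<psi> z * f z))\<^sup>2 \<partial>area) \<le> (\<integral>z. M\<^sup>2 * (cmod (f z))\<^sup>2 \<partial>area)"
    by (rule integral_mono[OF int' int pt])
  then have "L2_norm (\<lambda>z. \<psi> z * f z) \<le> sqrt (M\<^sup>2 * (\<integral>z. (cmod (f z))\<^sup>2 \<partial>area))"
    by (simp add: L2_norm_def)
  then show "L2_norm (\<lambda>z. \<psi> z * f z) \<le> M * L2_norm f"
    using M by (simp add: L2_norm_def real_sqrt_mult)
qed

lemma L2_scale: "f \<in> L2 \<Longrightarrow> (\<lambda>z. a * f z) \<in> L2"
  by (rule L2_mult_bounded(1)[of "\<lambda>_. a" "cmod a"]) auto

lemma L2_add:
  assumes f: "f \<in> L2" and h: "h \<in> L2"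
  shows "(\<lambda>z. f z + h z) \<in> L2"
proof -
  note [measurable] = L2_measurable[OF f] L2_measurable[OF h]
  have "integrable area (\<lambda>z. (cmod (f z + h z))\<^sup>2)"
  proof (rule Bochner_Integration.integrable_bound)
    show "integrable area (\<lambda>z. 2 * (cmod (f z))\<^sup>2 + 2 * (cmod (h z))\<^sup>2)"
      using L2_square_integrable[OF f] L2_square_integrable[OF h] by simp
    have "(cmod (f z + h z))\<^sup>2 \<le> 2 * (cmod (f z))\<^sup>2 + 2 * (cmod (h z))\<^sup>2" for z
    proof -
      have "(cmod (f z + h z))\<^sup>2 \<le> (cmod (f z) + cmod (h z))\<^sup>2"
        by (simp add: norm_triangle_ineq power_mono)
      also have "\<dots> \<le> 2 * (cmod (f z))\<^sup>2 + 2 * (cmod (h z))\<^sup>2"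
        using sum_squares_bound[of "cmod (f z)" "cmod (h z)"] by (simp add: power2_sum)
      finally show ?thesis .
    qed
    then show "AE z in area. norm ((cmod (f z + h z))\<^sup>2) \<le> norm (2 * (cmod (f z))\<^sup>2 + 2 * (cmod (h z))\<^sup>2)"
      by simp
  qed measurable
  then show ?thesis by (simp add: L2_def)
qed

lemma L2_diff: "f \<in> L2 \<Longrightarrow> h \<in> L2 \<Longrightarrow> (\<lambda>z. f z - h z) \<in> L2"
  using L2_add[of f "\<lambda>z. (-1) * h z"] L2_scale[of h "-1"] by simp

lemma L2_inner_add_left:
  "f \<in> L2 \<Longrightarrow> g \<in> L2 \<Longrightarrow> h \<in> L2 \<Longrightarrow> L2_inner (\<lambda>z. f z + g z) h = L2_inner f h + L2_inner g h"
  by (simp add: L2_inner_def ring_distribs L2_inner_integrable)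

lemma L2_inner_diff_left:
  "f \<in> L2 \<Longrightarrow> g \<in> L2 \<Longrightarrow> h \<in> L2 \<Longrightarrow> L2_inner (\<lambda>z. f z - g z) h = L2_inner f h - L2_inner g h"
  by (simp add: L2_inner_def ring_distribs L2_inner_integrable)

lemma L2_inner_scale_left: "L2_inner (\<lambda>z. a * f z) h = a * L2_inner f h"
  by (simp add: L2_inner_def mult.assoc)

lemma L2_inner_commute: "L2_inner h f = cnj (L2_inner f h)"
proof -
  have "cnj (L2_inner f h) = (\<integral>z. cnj (f z * cnj (h z)) \<partial>area)"
    unfolding L2_inner_def by (rule Bochner_Integration.integral_cnj[symmetric])
  then show ?thesis by (simp add: L2_inner_def mult.commute)
qed

lemma L2_inner_scale_right: "L2_inner f (\<lambda>z. a * h z) = cnj a * L2_inner f h"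
  by (metis L2_inner_commute L2_inner_scale_left complex_cnj_mult)

lemma L2_norm_nonneg [simp]: "0 \<le> L2_norm f"
  by (simp add: L2_norm_def)

lemma L2_norm_square: "(L2_norm f)\<^sup>2 = (\<integral>z. (cmod (f z))\<^sup>2 \<partial>area)"
  by (simp add: L2_norm_def)

lemma L2_inner_self: "L2_inner f f = of_real ((L2_norm f)\<^sup>2)"
  unfolding L2_norm_square L2_inner_def complex_norm_square[symmetric]
  by (rule integral_complex_of_real)

lemma L2_norm_scale: "L2_norm (\<lambda>z. a * f z) = cmod a * L2_norm f"
  by (simp add: L2_norm_def norm_mult power_mult_distrib real_sqrt_mult)

lemma L2_norm_cong: "(\<And>z. z \<in> unit_disc \<Longrightarrow> f z = h z) \<Longrightarrow> L2_norm f = L2_norm h"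
  unfolding L2_norm_def by (auto intro!: arg_cong[of _ _ sqrt] Bochner_Integration.integral_cong simp: space_area)

lemma L2_norm_mono:
  assumes f: "f \<in> L2" and h: "h \<in> L2" and le: "\<And>z. z \<in> unit_disc \<Longrightarrow> cmod (f z) \<le> cmod (h z)"
  shows "L2_norm f \<le> L2_norm h"
  unfolding L2_norm_def
  using le by (intro real_sqrt_le_mono integral_mono L2_square_integrable f h power_mono) (auto simp: space_area)

lemma L2_norm_minus_commute: "L2_norm (\<lambda>z. f z - h z) = L2_norm (\<lambda>z. h z - f z)"
  by (simp add: L2_norm_def norm_minus_commute)

lemma L2_norm_diff_square:
  assumes f: "f \<in> L2" and h: "h \<in> L2"
  shows "(L2_norm (\<lambda>z. f z - h z))\<^sup>2 = (L2_norm f)\<^sup>2 - 2 * Re (L2_inner f h) + (L2_norm h)\<^sup>2"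
proof -
  have "(L2_norm (\<lambda>z. f z - h z))\<^sup>2 = Re (L2_inner (\<lambda>z. f z - h z) (\<lambda>z. f z - h z))"
    by (simp add: L2_inner_self)
  also have "L2_inner (\<lambda>z. f z - h z) (\<lambda>z. f z - h z)
      = L2_inner f (\<lambda>z. f z - h z) - L2_inner h (\<lambda>z. f z - h z)"
    by (intro L2_inner_diff_left L2_diff f h)
  also have "L2_inner f (\<lambda>z. f z - h z) = cnj (L2_inner f f - L2_inner h f)"
    using f h by (subst L2_inner_commute) (simp add: L2_inner_diff_left)
  also have "L2_inner h (\<lambda>z. f z - h z) = cnj (L2_inner f h - L2_inner h h)"
    using f h by (subst L2_inner_commute) (simp add: L2_inner_diff_left)
  finally show ?thesis
    using L2_inner_commute[of h f] by (simp add: L2_inner_self)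
qed

lemma L2_norm_add_square:
  assumes f: "f \<in> L2" and h: "h \<in> L2"
  shows "(L2_norm (\<lambda>z. f z + h z))\<^sup>2 = (L2_norm f)\<^sup>2 + 2 * Re (L2_inner f h) + (L2_norm h)\<^sup>2"
  using L2_norm_diff_square[OF f L2_scale[OF h, of "-1"]] L2_norm_scale[of "-1" h]
    L2_inner_scale_right[of f "-1" h]
  by simp

text \<open>
  The usual discriminant argument, along the multiples \<open>s * t * h\<close> where \<open>t\<close> is the inner product
  itself. The form is only semidefinite, so a null vector \<open>h\<close> needs its own argument.
\<close>
lemma L2_Cauchy_Schwarz:
  assumes f: "f \<in> L2" and h: "h \<in> L2"
  shows "cmod (L2_inner f h) \<le> L2_norm f * L2_norm h"
proof -
  define t where "t = L2_inner f h"
  have main: "0 \<le> (L2_norm f)\<^sup>2 - 2 * s * (cmod t)\<^sup>2 + s\<^sup>2 * (cmod t)\<^sup>2 * (L2_norm h)\<^sup>2" for s :: real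
  proof -
    have "0 \<le> (L2_norm (\<lambda>z. f z - of_real s * t * h z))\<^sup>2"
      by simp
    also have "\<dots> = (L2_norm f)\<^sup>2 - 2 * Re (L2_inner f (\<lambda>z. of_real s * t * h z)) + (L2_norm (\<lambda>z. of_real s * t * h z))\<^sup>2"
      using f h by (intro L2_norm_diff_square L2_scale)
    also have "L2_inner f (\<lambda>z. of_real s * t * h z) = of_real (s * (cmod t)\<^sup>2)"
      unfolding L2_inner_scale_right t_def[symmetric] of_real_mult complex_norm_square by simp
    also have "(L2_norm (\<lambda>z. of_real s * t * h z))\<^sup>2 = s\<^sup>2 * (cmod t)\<^sup>2 * (L2_norm h)\<^sup>2"
      by (simp add: L2_norm_scale norm_mult power_mult_distrib)
    finally show ?thesis by simp
  qed
  show ?thesis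
  proof (cases "L2_norm h = 0")
    case True
    \<comment> \<open>The quadratic is then affine in \<open>s\<close>, and bounded below only if its slope vanishes.\<close>
    have "t = 0"
    proof (rule ccontr)
      assume "t \<noteq> 0"
      then show False
        using main[of "((L2_norm f)\<^sup>2 + 1) / (2 * (cmod t)\<^sup>2)"] True by simp
    qed
    then show ?thesis by (simp add: t_def)
  next
    case False
    \<comment> \<open>The minimizing value of \<open>s\<close>.\<close>
    have "0 \<le> (L2_norm f)\<^sup>2 - (cmod t)\<^sup>2 / (L2_norm h)\<^sup>2"
      using main[of "1 / (L2_norm h)\<^sup>2"] False by (simp add: field_simps power2_eq_square)
    then have "(cmod t)\<^sup>2 \<le> (L2_norm f * L2_norm h)\<^sup>2"
      using False by (simp add: field_simps power_mult_distrib)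
    then show ?thesis
      unfolding t_def by (rule power2_le_imp_le) simp
  qed
qed

lemma L2_norm_triangle:
  assumes f: "f \<in> L2" and h: "h \<in> L2"
  shows "L2_norm (\<lambda>z. f z + h z) \<le> L2_norm f + L2_norm h"
proof (rule power2_le_imp_le)
  have "Re (L2_inner f h) \<le> L2_norm f * L2_norm h"
    using L2_Cauchy_Schwarz[OF f h] complex_Re_le_cmod order_trans by blast
  then show "(L2_norm (\<lambda>z. f z + h z))\<^sup>2 \<le> (L2_norm f + L2_norm h)\<^sup>2"
    by (simp add: L2_norm_add_square[OF f h] power2_sum)
qed simp

lemma L2_norm_triangle_diff:
  assumes "f \<in> L2" "g \<in> L2" "h \<in> L2"
  shows "L2_norm (\<lambda>z. f z - h z) \<le> L2_norm (\<lambda>z. f z - g z) + L2_norm (\<lambda>z. g z - h z)"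
  using L2_norm_triangle[of "\<lambda>z. f z - g z" "\<lambda>z. g z - h z"] assms by (simp add: L2_diff)

section \<open>The Bergman space and its reproducing kernel\<close>

lemma bergmanD:
  assumes "f \<in> bergman"
  shows "f \<in> L2" "f holomorphic_on unit_disc" "\<And>z. z \<notin> unit_disc \<Longrightarrow> f z = 0"
  using assms by (auto simp: bergman_def)

lemma bergman_eqI:
  assumes "f \<in> bergman" "h \<in> bergman" "\<And>z. z \<in> unit_disc \<Longrightarrow> f z = h z"
  shows "f = h"
  using assms bergmanD(3) by (metis ext)

lemma bergman_add: "f \<in> bergman \<Longrightarrow> h \<in> bergman \<Longrightarrow> (\<lambda>z. f z + h z) \<in> bergman"
  by (auto simp: bergman_def intro!: L2_add holomorphic_intros)

lemma bergman_diff: "f \<in> bergman \<Longrightarrow> h \<in> bergman \<Longrightarrow> (\<lambda>z. f z - h z) \<in> bergman"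
  by (auto simp: bergman_def intro!: L2_diff holomorphic_intros)

lemma bergman_scale: "f \<in> bergman \<Longrightarrow> (\<lambda>z. a * f z) \<in> bergman"
  by (auto simp: bergman_def intro!: L2_scale holomorphic_intros)

lemma bergman_zero: "(\<lambda>z. 0) \<in> bergman"
  by (auto simp: bergman_def L2_def)

lemma H_infinity_bound:
  assumes "g \<in> H_infinity"
  obtains M where "\<And>z. z \<in> unit_disc \<Longrightarrow> cmod (g z) \<le> M" "M > 0"
proof -
  from assms obtain B where "B > 0" "\<forall>w\<in>g ` unit_disc. cmod w \<le> B"
    unfolding H_infinity_def bounded_pos by blast
  then show ?thesis
    by (intro that[of B]) auto
qed

lemma H_infinity_measurable: "g \<in> H_infinity \<Longrightarrow> g \<in> borel_measurable area"
  by (auto simp: H_infinity_def intro!: borel_measurable_area holomorphic_on_imp_continuous_on)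

lemma H_infinity_inverse_diff:
  assumes g: "g \<in> H_infinity" and e: "e > 0" "\<And>z. z \<in> unit_disc \<Longrightarrow> e \<le> cmod (g z - a)"
  shows "(\<lambda>z. 1 / (g z - a)) \<in> H_infinity"
proof -
  have nz: "g z - a \<noteq> 0" if "z \<in> unit_disc" for z
    using e(1) e(2)[OF that] by auto
  have "(\<lambda>z. 1 / (g z - a)) holomorphic_on unit_disc"
    using g nz by (intro holomorphic_intros) (auto simp: H_infinity_def)
  moreover have "cmod (1 / (g z - a)) \<le> 1 / e" if "z \<in> unit_disc" for z
    unfolding norm_divide norm_one using e(1) e(2)[OF that] by (intro divide_left_mono mult_pos_pos) auto
  ultimately show ?thesis
    by (auto simp: H_infinity_def bounded_iff intro!: exI[of _ "1 / e"])
qed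

lemma H_infinity_inverse:
  assumes "g \<in> H_infinity" "e > 0" "\<And>z. z \<in> unit_disc \<Longrightarrow> e \<le> cmod (g z)"
  shows "(\<lambda>z. 1 / g z) \<in> H_infinity"
  using H_infinity_inverse_diff[of g e 0] assms by simp

lemma const_H_infinity: "(\<lambda>_. a) \<in> H_infinity"
  by (simp add: H_infinity_def image_constant_conv)

lemma bergman_mult_H_infinity:
  assumes g: "g \<in> H_infinity" and f: "f \<in> bergman"
  shows "(\<lambda>z. g z * f z) \<in> bergman"
proof -
  obtain M where "\<And>z. z \<in> unit_disc \<Longrightarrow> cmod (g z) \<le> M"
    using H_infinity_bound[OF g] by blast
  then have "(\<lambda>z. g z * f z) \<in> L2"
    using L2_mult_bounded(1)[OF H_infinity_measurable[OF g]] bergmanD(1)[OF f] by blast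
  with g f show ?thesis
    by (auto simp: bergman_def H_infinity_def intro!: holomorphic_intros)
qed

lemma bergman_kernel_holomorphic:
  assumes "z \<in> unit_disc"
  shows "bergman_kernel z holomorphic_on unit_disc"
proof -
  have "1 - cnj z * w \<noteq> 0" if "w \<in> unit_disc" for w
  proof -
    have "cmod (cnj z * w) < 1 * 1"
      unfolding norm_mult using assms that by (intro mult_strict_mono') auto
    then show ?thesis by auto
  qed
  then have "(\<lambda>w. 1 / (1 - cnj z * w)\<^sup>2) holomorphic_on unit_disc"
    by (intro holomorphic_intros) auto
  then show ?thesis
    by (rule holomorphic_transform) (simp add: bergman_kernel_def)
qed

lemma bergman_kernel_bound:
  assumes "z \<in> unit_disc"
  shows "cmod (bergman_kernel z w) \<le> 1 / (1 - cmod z)\<^sup>2"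
proof (cases "w \<in> unit_disc")
  case True
  have "cmod z < 1" using assms by simp
  have "cmod z * cmod w \<le> cmod z * 1"
    using True by (intro mult_left_mono) auto
  then have "1 - cmod z \<le> cmod (1 - cnj z * w)"
    using norm_triangle_ineq2[of 1 "cnj z * w"] by (simp add: norm_mult)
  then have "(1 - cmod z)\<^sup>2 \<le> (cmod (1 - cnj z * w))\<^sup>2"
    using \<open>cmod z < 1\<close> by (intro power_mono) auto
  then show ?thesis
    using True \<open>cmod z < 1\<close>
    by (auto simp: bergman_kernel_def norm_divide norm_power intro!: divide_left_mono mult_pos_pos elim: less_le_trans[rotated])
qed (simp add: bergman_kernel_def)

lemma L2_bounded:
  assumes "f \<in> borel_measurable area" "\<And>z. z \<in> unit_disc \<Longrightarrow> cmod (f z) \<le> M"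
  shows "f \<in> L2"
  using L2_mult_bounded(1)[OF assms, of "\<lambda>_. 1"] by (simp add: L2_def)

lemma bergman_kernel_bergman:
  assumes "z \<in> unit_disc"
  shows "bergman_kernel z \<in> bergman"
proof -
  have "bergman_kernel z \<in> borel_measurable area"
    using bergman_kernel_holomorphic[OF assms]
    by (intro borel_measurable_area holomorphic_on_imp_continuous_on)
  then have "bergman_kernel z \<in> L2"
    by (rule L2_bounded) (rule bergman_kernel_bound[OF assms])
  then show ?thesis
    using bergman_kernel_holomorphic[OF assms] by (simp add: bergman_def bergman_kernel_def)
qed

lemma bergman_kernel_sums:
  assumes "z \<in> unit_disc" "w \<in> unit_disc"
  shows "(\<lambda>n. of_nat (Suc n) * cnj z ^ n * w ^ n) sums bergman_kernel z w"
proof -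
  have "cmod (cnj z * w) < 1 * 1"
    unfolding norm_mult using assms by (intro mult_strict_mono') auto
  then have "(\<lambda>n. of_nat (Suc n) * (cnj z * w) ^ n) sums (1 / (1 - cnj z * w)\<^sup>2)"
    by (intro geometric_deriv_sums) simp
  then show ?thesis
    using assms by (simp add: bergman_kernel_def power_mult_distrib mult.assoc)
qed

text \<open>
  Multiply the power series of \<open>f\<close> and of the conjugated kernel, both absolutely convergent for
  \<open>cmod w < r\<close>, and integrate term by term: orthogonality leaves the diagonal, where the weight
  \<open>n + 1\<close> of the kernel cancels the norm of the monomial.
\<close>
lemma inner_bergman_kernel_on_subdisc:
  assumes f: "f \<in> bergman" and z: "z \<in> unit_disc" and r: "0 < r" "r < 1"
  shows "(\<integral>w. indicator (ball 0 r) w *\<^sub>R (f w * cnj (bergman_kernel z w)) \<partial>area) = of_real (r\<^sup>2) * f (of_real (r\<^sup>2) * z)"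
proof -
  define a where "a n = (deriv ^^ n) f 0 / fact n" for n
  have hol: "f holomorphic_on unit_disc"
    using f by (rule bergmanD)
  have f_sums: "(\<lambda>n. a n * w ^ n) sums f w" if "w \<in> unit_disc" for w
    using holomorphic_power_series[OF hol that] by (simp add: a_def)
  define b where "b n = of_nat (Suc n) * z ^ n" for n
  have k_sums: "(\<lambda>n. b n * cnj w ^ n) sums cnj (bergman_kernel z w)" if "w \<in> unit_disc" for w
    using sums_cnj[THEN iffD2, OF bergman_kernel_sums[OF z that]] by (simp add: b_def)
  have a_abs: "summable (\<lambda>n. norm (a n) * r ^ n)"
  proof -
    \<comment> \<open>Convergence at the larger radius \<open>(r + 1) / 2\<close> gives absolute convergence at \<open>r\<close>.\<close>
    have "summable (\<lambda>n. norm (a n * of_real r ^ n))"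
      by (rule powser_insidea[OF sums_summable[OF f_sums[of "of_real ((r + 1) / 2)"]]]) (use r in auto)
    then show ?thesis using r by (simp add: norm_mult norm_power)
  qed
  have b_abs: "summable (\<lambda>n. norm (b n) * r ^ n)"
  proof -
    have "summable (\<lambda>n. norm (b n * of_real r ^ n))"
    proof (rule powser_insidea)
      show "summable (\<lambda>n. b n * of_real ((r + 1) / 2) ^ n)"
        using sums_summable[OF k_sums[of "of_real ((r + 1) / 2)"]] r by simp
    qed (use r in auto)
    then show ?thesis using r by (simp add: norm_mult norm_power)
  qed
  define F where "F N w = indicator (ball 0 r) w *\<^sub>R ((\<Sum>m<N. a m * w ^ m) * (\<Sum>n<N. b n * cnj w ^ n))" for N w
  let ?I = "\<lambda>m n. (\<integral>w. indicator (ball 0 r) w *\<^sub>R (w ^ m * cnj w ^ n) \<partial>area)"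
  have int: "integrable area (\<lambda>w. indicator (ball 0 r) w *\<^sub>R (w ^ m * cnj w ^ n))" for m n
  proof (rule area.integrable_const_bound[of _ 1])
    show "(\<lambda>w. indicator (ball 0 r) w *\<^sub>R (w ^ m * cnj w ^ n)) \<in> borel_measurable area"
      by (intro borel_measurable_scaleR indicator_ball_measurable_area borel_measurable_area continuous_intros)
    have "norm (indicator (ball 0 r) w *\<^sub>R (w ^ m * cnj w ^ n)) \<le> 1" for w :: complex
      using r by (auto simp: indicator_def norm_mult norm_power intro!: mult_le_one power_le_one)
    then show "AE w in area. norm (indicator (ball 0 r) w *\<^sub>R (w ^ m * cnj w ^ n)) \<le> 1"
      by simp
  qed
  have F_eq: "F N w = (\<Sum>m<N. \<Sum>n<N. (a m * b n) * indicator (ball 0 r) w *\<^sub>R (w ^ m * cnj w ^ n))" for N w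
    by (simp add: F_def sum_product scaleR_sum_right mult_ac)
  have F_int: "(\<integral>w. F N w \<partial>area) = of_real (r\<^sup>2) * (\<Sum>n<N. a n * (of_real (r\<^sup>2) * z) ^ n)" for N
  proof -
    have "(\<integral>w. F N w \<partial>area) = (\<Sum>m<N. \<Sum>n<N. (a m * b n) * ?I m n)"
      unfolding F_eq
      by (subst Bochner_Integration.integral_sum,
          intro Bochner_Integration.integrable_sum integrable_mult_right int,
          subst Bochner_Integration.integral_sum, intro integrable_mult_right int)
        (simp only: integral_mult_right_zero)
    also have "\<dots> = (\<Sum>m<N. \<Sum>n<N. if n = m then of_real (r\<^sup>2) * (a n * (of_real (r\<^sup>2) * z) ^ n) else 0)"
    proof (intro sum.cong refl)
      fix m n
      have "complex_of_real (r ^ (2 * n + 2) / (n + 1)) = of_real (r\<^sup>2) * of_real (r\<^sup>2) ^ n / of_nat (Suc n)"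
        by (simp add: power_add power_mult power2_eq_square)
      then have "(a n * b n) * ?I n n = of_real (r\<^sup>2) * (a n * (of_real (r\<^sup>2) * z) ^ n)"
        unfolding area_monomial_norm[OF less_imp_le[OF r(1)] less_imp_le[OF r(2)]] b_def
        by (simp add: power_mult_distrib del: of_nat_Suc of_real_power)
      then show "(a m * b n) * ?I m n = (if n = m then of_real (r\<^sup>2) * (a n * (of_real (r\<^sup>2) * z) ^ n) else 0)"
        using area_monomials_orthogonal[of m n r] by (cases "n = m") simp_all
    qed
    also have "\<dots> = of_real (r\<^sup>2) * (\<Sum>n<N. a n * (of_real (r\<^sup>2) * z) ^ n)"
      by (simp add: sum_distrib_left)
    finally show ?thesis .
  qed
  have "(\<lambda>N. \<integral>w. F N w \<partial>area) \<longlonglongrightarrow> (\<integral>w. indicator (ball 0 r) w *\<^sub>R (f w * cnj (bergman_kernel z w)) \<partial>area)"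
  proof (rule integral_dominated_convergence)
    let ?M = "(\<Sum>n. norm (a n) * r ^ n) * (\<Sum>n. norm (b n) * r ^ n)"
    show "integrable area (\<lambda>_. ?M)" by simp
    show "F N \<in> borel_measurable area" for N
      unfolding F_eq using int by (intro borel_measurable_sum borel_measurable_times borel_measurable_const borel_measurable_integrable)
    show "AE w in area. (\<lambda>N. F N w) \<longlonglongrightarrow> indicator (ball 0 r) w *\<^sub>R (f w * cnj (bergman_kernel z w))"
    proof (rule AE_I2)
      fix w assume "w \<in> space area"
      then have w: "w \<in> unit_disc" by (simp add: space_area)
      show "(\<lambda>N. F N w) \<longlonglongrightarrow> indicator (ball 0 r) w *\<^sub>R (f w * cnj (bergman_kernel z w))"
        unfolding F_def using f_sums[OF w] k_sums[OF w] unfolding sums_def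
        by (intro tendsto_intros)
    qed
    show "AE w in area. norm (F N w) \<le> ?M" for N
    proof (rule AE_I2)
      fix w
      have part: "norm (\<Sum>m<N. c m * v ^ m) \<le> (\<Sum>n. norm (c n) * r ^ n)"
        if "summable (\<lambda>n. norm (c n) * r ^ n)" "cmod v \<le> r" for c :: "nat \<Rightarrow> complex" and v
      proof -
        have "norm (\<Sum>m<N. c m * v ^ m) \<le> (\<Sum>m<N. norm (c m) * r ^ m)"
          using that(2) by (intro sum_norm_le) (auto simp: norm_mult norm_power intro!: mult_left_mono power_mono)
        also have "\<dots> \<le> (\<Sum>n. norm (c n) * r ^ n)"
          using that(1) r by (intro sum_le_suminf) auto
        finally show ?thesis .
      qed
      have "0 \<le> ?M"
        using a_abs b_abs r by (intro mult_nonneg_nonneg suminf_nonneg) auto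
      moreover have "norm (F N w) \<le> ?M" if "w \<in> ball 0 r"
      proof -
        have "norm (F N w) = norm (\<Sum>m<N. a m * w ^ m) * norm (\<Sum>n<N. b n * cnj w ^ n)"
          using that by (simp add: F_def norm_mult)
        also have "\<dots> \<le> ?M"
          using that r by (intro mult_mono part a_abs b_abs suminf_nonneg) auto
        finally show ?thesis .
      qed
      ultimately show "norm (F N w) \<le> ?M"
        by (cases "w \<in> ball 0 r") (auto simp: F_def)
    qed
    show "(\<lambda>w. indicator (ball 0 r) w *\<^sub>R (f w * cnj (bergman_kernel z w))) \<in> borel_measurable area"
      using L2_inner_integrable[OF bergmanD(1)[OF f] bergmanD(1)[OF bergman_kernel_bergman[OF z]]]
      by (intro borel_measurable_scaleR indicator_ball_measurable_area borel_measurable_integrable)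
  qed
  moreover have "(\<lambda>N. \<integral>w. F N w \<partial>area) \<longlonglongrightarrow> of_real (r\<^sup>2) * f (of_real (r\<^sup>2) * z)"
  proof -
    have "cmod (of_real (r\<^sup>2) * z) < 1 * 1"
      unfolding norm_mult using z r by (intro mult_strict_mono') (auto simp: norm_power power_less_one_iff)
    then have "(\<lambda>n. a n * (of_real (r\<^sup>2) * z) ^ n) sums f (of_real (r\<^sup>2) * z)"
      by (intro f_sums) simp
    then show ?thesis
      unfolding F_int sums_def by (intro tendsto_intros)
  qed
  ultimately show ?thesis
    by (rule LIMSEQ_unique)
qed

text \<open>
  On the whole disc the power series of \<open>f\<close> need not converge absolutely up to the boundary, so the
  identity is taken on smaller discs and the radius tends to one by dominated convergence.
\<close>
lemma bergman_reproducing: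
  assumes f: "f \<in> bergman" and z: "z \<in> unit_disc"
  shows "L2_inner f (bergman_kernel z) = f z"
proof -
  define r :: "nat \<Rightarrow> real" where "r k = 1 - inverse (of_nat (Suc (Suc k)))" for k
  have r: "0 < r k" "r k < 1" for k
    by (auto simp: r_def field_simps)
  have rlim: "r \<longlonglongrightarrow> 1"
    using tendsto_diff[OF tendsto_const[of 1] LIMSEQ_Suc[OF LIMSEQ_inverse_real_of_nat]]
    by (simp add: r_def[abs_def])
  let ?F = "\<lambda>w. f w * cnj (bergman_kernel z w)"
  have int: "integrable area ?F"
    using f z by (intro L2_inner_integrable bergmanD bergman_kernel_bergman)
  have "(\<lambda>k. \<integral>w. indicator (ball 0 (r k)) w *\<^sub>R ?F w \<partial>area) \<longlonglongrightarrow> (\<integral>w. ?F w \<partial>area)"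
  proof (rule integral_dominated_convergence)
    show "integrable area (\<lambda>w. norm (?F w))"
      using int by simp
    show "?F \<in> borel_measurable area"
      using int by simp
    show "(\<lambda>w. indicator (ball 0 (r k)) w *\<^sub>R ?F w) \<in> borel_measurable area" for k
      using int by (intro borel_measurable_scaleR indicator_ball_measurable_area borel_measurable_integrable)
    show "AE w in area. norm (indicator (ball 0 (r k)) w *\<^sub>R ?F w) \<le> norm (?F w)" for k
      by (simp add: indicator_def)
    show "AE w in area. (\<lambda>k. indicator (ball 0 (r k)) w *\<^sub>R ?F w) \<longlonglongrightarrow> ?F w"
    proof (rule AE_I2)
      fix w assume "w \<in> space area"
      then have "cmod w < 1" by (simp add: space_area)
      then have "\<forall>\<^sub>F k in sequentially. cmod w < r k"
        using rlim order_tendstoD(1) by blast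
      then have "\<forall>\<^sub>F k in sequentially. indicator (ball 0 (r k)) w *\<^sub>R ?F w = ?F w"
        by (rule eventually_mono) simp
      then show "(\<lambda>k. indicator (ball 0 (r k)) w *\<^sub>R ?F w) \<longlonglongrightarrow> ?F w"
        by (rule tendsto_eventually)
    qed
  qed
  moreover have "(\<lambda>k. \<integral>w. indicator (ball 0 (r k)) w *\<^sub>R ?F w \<partial>area) \<longlonglongrightarrow> f z"
  proof -
    have "isCont f z"
      using bergmanD(2)[OF f] z by (meson holomorphic_on_imp_continuous_on continuous_on_eq_continuous_at open_ball)
    moreover have "(\<lambda>k. of_real ((r k)\<^sup>2) * z) \<longlonglongrightarrow> of_real (1\<^sup>2) * z"
      by (intro tendsto_intros rlim)
    ultimately have "(\<lambda>k. f (of_real ((r k)\<^sup>2) * z)) \<longlonglongrightarrow> f z"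
      using isCont_tendsto_compose[of z f "\<lambda>k. of_real ((r k)\<^sup>2) * z" sequentially] by simp
    moreover have "(\<lambda>k. of_real ((r k)\<^sup>2) :: complex) \<longlonglongrightarrow> of_real (1\<^sup>2)"
      by (intro tendsto_intros rlim)
    ultimately have "(\<lambda>k. of_real ((r k)\<^sup>2) * f (of_real ((r k)\<^sup>2) * z)) \<longlonglongrightarrow> of_real (1\<^sup>2) * f z"
      by (intro tendsto_mult)
    then show ?thesis
      by (simp add: inner_bergman_kernel_on_subdisc[OF f z r])
  qed
  ultimately show ?thesis
    unfolding L2_inner_def by (rule LIMSEQ_unique)
qed

lemma bergman_kernel_diagonal:
  assumes "z \<in> unit_disc"
  shows "bergman_kernel z z = of_real ((L2_norm (bergman_kernel z))\<^sup>2)"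
  unfolding L2_inner_self[symmetric]
  by (rule bergman_reproducing[OF bergman_kernel_bergman[OF assms] assms, symmetric])

lemma bergman_kernel_norm:
  assumes "z \<in> unit_disc"
  shows "L2_norm (bergman_kernel z) = 1 / (1 - (cmod z)\<^sup>2)"
proof -
  have z: "(cmod z)\<^sup>2 < 1" using assms by (simp add: power_less_one_iff)
  have "complex_of_real ((L2_norm (bergman_kernel z))\<^sup>2) = bergman_kernel z z"
    by (rule bergman_kernel_diagonal[OF assms, symmetric])
  also have "\<dots> = of_real ((1 / (1 - (cmod z)\<^sup>2))\<^sup>2)"
  proof -
    have "1 - cnj z * z = of_real (1 - (cmod z)\<^sup>2)"
      unfolding of_real_diff complex_norm_square by simp
    then show ?thesis
      using assms by (simp add: bergman_kernel_def power_divide)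
  qed
  finally have "(L2_norm (bergman_kernel z))\<^sup>2 = (1 / (1 - (cmod z)\<^sup>2))\<^sup>2"
    unfolding of_real_eq_iff .
  then show ?thesis
    using z by (simp add: power2_eq_iff_nonneg)
qed

lemma bergman_kernel_norm_pos:
  assumes "z \<in> unit_disc"
  shows "0 < L2_norm (bergman_kernel z)"
  using assms by (simp add: bergman_kernel_norm power_less_one_iff)

lemma bergman_evaluation_bound:
  assumes f: "f \<in> bergman" and z: "z \<in> unit_disc"
  shows "cmod (f z) \<le> L2_norm f * L2_norm (bergman_kernel z)"
  using L2_Cauchy_Schwarz[OF bergmanD(1)[OF f] bergmanD(1)[OF bergman_kernel_bergman[OF z]]]
  by (simp add: bergman_reproducing[OF f z])

text \<open>
  Point evaluations are bounded uniformly on each compact part of the disc; hence convergence in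
  norm is locally uniform, and limits stay analytic.
\<close>
lemma bergman_pointwise_bound:
  assumes f: "f \<in> bergman" and z: "z \<in> unit_disc"
  shows "cmod (f z) \<le> L2_norm f / (1 - (cmod z)\<^sup>2)"
  using bergman_evaluation_bound[OF f z] by (simp add: bergman_kernel_norm[OF z])

text \<open>
  Testing against the kernels \<open>u = bergman_kernel z\<close> recovers all values, so operators can be compared
  weakly.
\<close>
lemma bergman_eqI_inner:
  assumes f: "f \<in> bergman" and h: "h \<in> bergman" and eq: "\<And>u. u \<in> bergman \<Longrightarrow> L2_inner f u = L2_inner h u"
  shows "f = h"
proof (rule bergman_eqI[OF f h])
  fix z assume z: "z \<in> unit_disc"
  show "f z = h z"
    using eq[OF bergman_kernel_bergman[OF z]] bergman_reproducing[OF f z] bergman_reproducing[OF h z] by simp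
qed

lemma bergman_norm_eq_0:
  assumes f: "f \<in> bergman" and "L2_norm f = 0"
  shows "f z = 0"
  using bergman_pointwise_bound[OF f, of z] bergmanD(3)[OF f, of z] assms(2)
  by (cases "z \<in> unit_disc") auto

section \<open>Completeness of the Bergman space and orthogonal projection\<close>

text \<open>
  The limit is constructed pointwise. It is analytic because convergence is locally uniform, and
  it is the limit in norm by Fatou's lemma.
\<close>
lemma bergman_complete:
  assumes u: "\<And>n. u n \<in> bergman"
    and Cauchy: "\<And>e. e > 0 \<Longrightarrow> \<exists>N. \<forall>n\<ge>N. \<forall>m\<ge>N. L2_norm (\<lambda>z. u n z - u m z) < e"
  obtains f where "f \<in> bergman" "(\<lambda>n. L2_norm (\<lambda>z. u n z - f z)) \<longlonglongrightarrow> 0"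
proof -
  have diff: "(\<lambda>z. u n z - u m z) \<in> bergman" for n m
    using u by (intro bergman_diff)
  define f where "f z = lim (\<lambda>n. u n z)" for z
  have f_unif: "uniform_limit (cball 0 r) u f sequentially" if r: "0 \<le> r" "r < 1" for r
  proof -
    have "uniformly_Cauchy_on (cball 0 r) u"
      unfolding uniformly_Cauchy_on_def
    proof (intro allI impI)
      fix e :: real assume "e > 0"
      have r2: "0 < 1 - r\<^sup>2" using r by (simp add: power_less_one_iff)
      with \<open>e > 0\<close> obtain N where N: "\<And>n m. n \<ge> N \<Longrightarrow> m \<ge> N \<Longrightarrow> L2_norm (\<lambda>z. u n z - u m z) < e * (1 - r\<^sup>2)"
        using Cauchy[of "e * (1 - r\<^sup>2)"] by auto
      have "dist (u m z) (u n z) < e" if "z \<in> cball 0 r" "m \<ge> N" "n \<ge> N" for z m n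
      proof -
        have z: "cmod z \<le> r" using that by simp
        then have "(cmod z)\<^sup>2 \<le> r\<^sup>2" by (intro power_mono) auto
        have "dist (u m z) (u n z) \<le> L2_norm (\<lambda>z. u m z - u n z) / (1 - (cmod z)\<^sup>2)"
          unfolding dist_norm using z r by (intro bergman_pointwise_bound[OF diff]) simp
        also have "\<dots> \<le> L2_norm (\<lambda>z. u m z - u n z) / (1 - r\<^sup>2)"
          using r2 \<open>(cmod z)\<^sup>2 \<le> r\<^sup>2\<close> by (intro divide_left_mono mult_pos_pos) auto
        also have "\<dots> < e"
          using N[OF that(2,3)] r2 by (simp add: field_simps)
        finally show ?thesis .
      qed
      then show "\<exists>M. \<forall>x\<in>cball 0 r. \<forall>m\<ge>M. \<forall>n\<ge>M. dist (u m x) (u n x) < e"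
        by blast
    qed
    then show ?thesis
      unfolding f_def[abs_def]
      by (simp add: Cauchy_uniformly_convergent flip: uniformly_convergent_uniform_limit_iff)
  qed
  have f_lim: "(\<lambda>n. u n z) \<longlonglongrightarrow> f z" for z
  proof (cases "z \<in> unit_disc")
    case True
    then show ?thesis
      using tendsto_uniform_limitI[OF f_unif[of "cmod z"], of z] by simp
  next
    case False
    then have "u n z = 0" for n using bergmanD(3)[OF u] by blast
    then show ?thesis by (simp add: f_def)
  qed
  have f_hol: "f holomorphic_on unit_disc"
  proof (rule holomorphic_uniform_sequence[OF open_ball])
    show "u n holomorphic_on unit_disc" for n
      using u by (rule bergmanD)
    fix x :: complex assume x: "x \<in> unit_disc"
    define d where "d = (1 - cmod x) / 2"
    have d: "d > 0" "cmod x + d < 1" using x by (auto simp: d_def field_simps)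
    have sub: "cball x d \<subseteq> cball 0 (cmod x + d)"
    proof
      fix y assume "y \<in> cball x d"
      then show "y \<in> cball 0 (cmod x + d)"
        using norm_triangle_ineq[of x "y - x"] by (simp add: dist_norm norm_minus_commute)
    qed
    moreover have "cball 0 (cmod x + d) \<subseteq> unit_disc"
      using d by auto
    ultimately show "\<exists>d>0. cball x d \<subseteq> unit_disc \<and> uniform_limit (cball x d) u f sequentially"
      using d f_unif[of "cmod x + d"] uniform_limit_on_subset[OF _ sub] by (intro exI[of _ d]) auto
  qed
  have f0: "f z = 0" if "z \<notin> unit_disc" for z
  proof -
    have "u n z = 0" for n using bergmanD(3)[OF u] that by blast
    then show ?thesis by (simp add: f_def)
  qed
  have f_meas: "f \<in> borel_measurable area"
    using f_hol by (intro borel_measurable_area holomorphic_on_imp_continuous_on)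
  have close: "(\<lambda>z. u n z - f z) \<in> L2 \<and> L2_norm (\<lambda>z. u n z - f z) \<le> e"
    if e: "e > 0" and N: "\<And>m. m \<ge> N \<Longrightarrow> L2_norm (\<lambda>z. u n z - u m z) < e" for n e N
  proof -
    note [measurable] = f_meas L2_measurable[OF bergmanD(1)[OF u]]
    have "(\<integral>\<^sup>+ z. ennreal ((cmod (u n z - f z))\<^sup>2) \<partial>area)
        = (\<integral>\<^sup>+ z. liminf (\<lambda>m. ennreal ((cmod (u n z - u m z))\<^sup>2)) \<partial>area)"
    proof (rule nn_integral_cong)
      fix z
      have "(\<lambda>m. ennreal ((cmod (u n z - u m z))\<^sup>2)) \<longlonglongrightarrow> ennreal ((cmod (u n z - f z))\<^sup>2)"
        by (intro tendsto_intros f_lim)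
      then show "ennreal ((cmod (u n z - f z))\<^sup>2) = liminf (\<lambda>m. ennreal ((cmod (u n z - u m z))\<^sup>2))"
        by (intro lim_imp_Liminf[symmetric] trivial_limit_sequentially)
    qed
    also have "\<dots> \<le> liminf (\<lambda>m. \<integral>\<^sup>+ z. ennreal ((cmod (u n z - u m z))\<^sup>2) \<partial>area)"
      by (rule nn_integral_liminf) measurable
    also have "\<dots> \<le> ennreal (e\<^sup>2)"
    proof (rule Liminf_le)
      have "(\<integral>\<^sup>+ z. ennreal ((cmod (u n z - u m z))\<^sup>2) \<partial>area) \<le> ennreal (e\<^sup>2)" if "m \<ge> N" for m
      proof -
        have "(\<integral>\<^sup>+ z. ennreal ((cmod (u n z - u m z))\<^sup>2) \<partial>area) = ennreal ((L2_norm (\<lambda>z. u n z - u m z))\<^sup>2)"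
          unfolding L2_norm_square
          by (intro nn_integral_eq_integral L2_square_integrable bergmanD(1)[OF diff]) simp
        also have "\<dots> \<le> ennreal (e\<^sup>2)"
          using N[OF that] by (intro ennreal_leI power_mono) auto
        finally show ?thesis .
      qed
      then show "\<forall>\<^sub>F m in sequentially. (\<integral>\<^sup>+ z. ennreal ((cmod (u n z - u m z))\<^sup>2) \<partial>area) \<le> ennreal (e\<^sup>2)"
        unfolding eventually_sequentially by blast
    qed simp
    finally have le: "(\<integral>\<^sup>+ z. ennreal ((cmod (u n z - f z))\<^sup>2) \<partial>area) \<le> ennreal (e\<^sup>2)" .
    then have int: "integrable area (\<lambda>z. (cmod (u n z - f z))\<^sup>2)"
      by (intro integrableI_bounded) (auto simp: order_le_less_trans)
    have "ennreal ((L2_norm (\<lambda>z. u n z - f z))\<^sup>2) \<le> ennreal (e\<^sup>2)"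
      unfolding L2_norm_square using le by (subst nn_integral_eq_integral[symmetric, OF int]) auto
    then have "L2_norm (\<lambda>z. u n z - f z) \<le> e"
      using e by (simp add: power_mono_iff)
    with int show ?thesis
      by (simp add: L2_def)
  qed
  have f_L2: "f \<in> L2"
  proof -
    obtain N where "\<And>m. m \<ge> N \<Longrightarrow> L2_norm (\<lambda>z. u N z - u m z) < 1"
      using Cauchy[of 1] by auto
    then have "(\<lambda>z. u N z - f z) \<in> L2"
      using close[of 1 N N] by simp
    from L2_diff[OF bergmanD(1)[OF u[of N]] this] show ?thesis by simp
  qed
  show ?thesis
  proof
    show "f \<in> bergman"
      using f_L2 f_hol f0 by (simp add: bergman_def)
    show "(\<lambda>n. L2_norm (\<lambda>z. u n z - f z)) \<longlonglongrightarrow> 0"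
    proof (rule LIMSEQ_I)
      fix e :: real assume e: "e > 0"
      then obtain N where "\<And>n m. n \<ge> N \<Longrightarrow> m \<ge> N \<Longrightarrow> L2_norm (\<lambda>z. u n z - u m z) < e / 2"
        using Cauchy[of "e / 2"] by auto
      then have "L2_norm (\<lambda>z. u n z - f z) \<le> e / 2" if "n \<ge> N" for n
        using close[of "e / 2" N n] e that by simp
      then show "\<exists>N. \<forall>n\<ge>N. norm (L2_norm (\<lambda>z. u n z - f z) - 0) < e"
        using e by (intro exI[of _ N]) (force intro: le_less_trans)
    qed
  qed
qed

lemma L2_parallelogram:
  assumes "f \<in> L2" "h \<in> L2"
  shows "(L2_norm (\<lambda>z. f z - h z))\<^sup>2 = 2 * (L2_norm f)\<^sup>2 + 2 * (L2_norm h)\<^sup>2 - 4 * (L2_norm (\<lambda>z. (f z + h z) / 2))\<^sup>2"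
proof -
  have "(L2_norm (\<lambda>z. (f z + h z) / 2))\<^sup>2 = (L2_norm (\<lambda>z. f z + h z))\<^sup>2 / 4"
  proof -
    have "L2_norm (\<lambda>z. (f z + h z) / 2) = cmod (1 / 2) * L2_norm (\<lambda>z. f z + h z)"
      unfolding L2_norm_scale[symmetric] by simp
    then show ?thesis by (simp only:) (simp add: power_divide power_mult_distrib)
  qed
  then show ?thesis
    by (simp add: L2_norm_add_square[OF assms] L2_norm_diff_square[OF assms])
qed

text \<open>
  A minimizing sequence is Cauchy by the parallelogram law, since midpoints of approximants cannot
  come closer to \<open>h\<close> than the infimum.
\<close>
lemma bergman_best_approximation:
  assumes h: "h \<in> L2"
  obtains f where "f \<in> bergman" "\<And>u. u \<in> bergman \<Longrightarrow> L2_norm (\<lambda>z. h z - f z) \<le> L2_norm (\<lambda>z. h z - u z)"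
proof -
  define D where "D = (\<lambda>u. (L2_norm (\<lambda>z. h z - u z))\<^sup>2) ` bergman"
  define d where "d = Inf D"
  have D: "D \<noteq> {}" "bdd_below D"
    using bergman_zero by (auto simp: D_def intro!: bdd_belowI2[of _ 0])
  have d_le: "d \<le> (L2_norm (\<lambda>z. h z - u z))\<^sup>2" if "u \<in> bergman" for u
    unfolding d_def using that by (intro cInf_lower D) (simp add: D_def)
  have "\<exists>u\<in>bergman. (L2_norm (\<lambda>z. h z - u z))\<^sup>2 < d + e" if "e > 0" for e
  proof -
    have "Inf D < d + e" using that by (simp add: d_def)
    then obtain x where "x \<in> D" "x < d + e"
      using cInf_lessD[OF D(1)] by blast
    then show ?thesis unfolding D_def by blast
  qed
  then have "\<exists>u\<in>bergman. (L2_norm (\<lambda>z. h z - u z))\<^sup>2 < d + inverse (real (Suc n))" for n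
    by simp
  then obtain u where u: "\<And>n. u n \<in> bergman" and
    u_lt: "\<And>n. (L2_norm (\<lambda>z. h z - u n z))\<^sup>2 < d + inverse (real (Suc n))"
    by metis
  note hu = L2_diff[OF h bergmanD(1)[OF u]]
  have dist: "(L2_norm (\<lambda>z. u n z - u m z))\<^sup>2 \<le> 2 * inverse (real (Suc n)) + 2 * inverse (real (Suc m))" for n m
  proof -
    have mid: "(\<lambda>z. (u n z + u m z) / 2) \<in> bergman"
      using bergman_scale[OF bergman_add[OF u u], of "1/2" n m] by simp
    have "L2_norm (\<lambda>z. u n z - u m z) = L2_norm (\<lambda>z. (h z - u m z) - (h z - u n z))"
      by simp
    then have "(L2_norm (\<lambda>z. u n z - u m z))\<^sup>2 = 2 * (L2_norm (\<lambda>z. h z - u m z))\<^sup>2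
        + 2 * (L2_norm (\<lambda>z. h z - u n z))\<^sup>2 - 4 * (L2_norm (\<lambda>z. h z - (u n z + u m z) / 2))\<^sup>2"
      using L2_parallelogram[OF hu hu, of m n] by (simp add: field_simps)
    with d_le[OF mid] u_lt[of n] u_lt[of m] show ?thesis by simp
  qed
  have Cauchy: "\<exists>N. \<forall>n\<ge>N. \<forall>m\<ge>N. L2_norm (\<lambda>z. u n z - u m z) < e" if e: "e > 0" for e
  proof -
    obtain N where N: "inverse (real (Suc N)) < e\<^sup>2 / 4"
      using reals_Archimedean[of "e\<^sup>2 / 4"] e by auto
    have "L2_norm (\<lambda>z. u n z - u m z) < e" if "n \<ge> N" "m \<ge> N" for n m
    proof (rule power2_less_imp_less)
      have "inverse (real (Suc n)) \<le> inverse (real (Suc N))" "inverse (real (Suc m)) \<le> inverse (real (Suc N))"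
        using that by (auto intro!: le_imp_inverse_le)
      then show "(L2_norm (\<lambda>z. u n z - u m z))\<^sup>2 < e\<^sup>2"
        using dist[of n m] N by linarith
    qed (use e in simp)
    then show ?thesis by blast
  qed
  obtain f where f: "f \<in> bergman" and lim: "(\<lambda>n. L2_norm (\<lambda>z. u n z - f z)) \<longlonglongrightarrow> 0"
    by (rule bergman_complete[of u, OF u Cauchy])
  have "L2_norm (\<lambda>z. h z - f z) \<le> L2_norm (\<lambda>z. h z - v z)" if v: "v \<in> bergman" for v
  proof (rule LIMSEQ_le)
    show "(\<lambda>n. L2_norm (\<lambda>z. h z - f z)) \<longlonglongrightarrow> L2_norm (\<lambda>z. h z - f z)"
      by simp
    have "(\<lambda>n. sqrt ((L2_norm (\<lambda>z. h z - v z))\<^sup>2 + inverse (real (Suc n))) + L2_norm (\<lambda>z. u n z - f z))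
        \<longlonglongrightarrow> sqrt ((L2_norm (\<lambda>z. h z - v z))\<^sup>2 + 0) + 0"
      by (intro tendsto_intros lim LIMSEQ_inverse_real_of_nat)
    then show "(\<lambda>n. sqrt ((L2_norm (\<lambda>z. h z - v z))\<^sup>2 + inverse (real (Suc n))) + L2_norm (\<lambda>z. u n z - f z))
        \<longlonglongrightarrow> L2_norm (\<lambda>z. h z - v z)"
      by simp
    have "L2_norm (\<lambda>z. h z - f z) \<le> sqrt ((L2_norm (\<lambda>z. h z - v z))\<^sup>2 + inverse (real (Suc n))) + L2_norm (\<lambda>z. u n z - f z)" for n
    proof -
      have "L2_norm (\<lambda>z. h z - f z) \<le> L2_norm (\<lambda>z. h z - u n z) + L2_norm (\<lambda>z. u n z - f z)"
        by (rule L2_norm_triangle_diff[OF h bergmanD(1)[OF u] bergmanD(1)[OF f]])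
      moreover have "L2_norm (\<lambda>z. h z - u n z) \<le> sqrt ((L2_norm (\<lambda>z. h z - v z))\<^sup>2 + inverse (real (Suc n)))"
        using u_lt[of n] d_le[OF v] by (intro real_le_rsqrt) linarith
      ultimately show ?thesis by linarith
    qed
    then show "\<exists>N. \<forall>n\<ge>N. L2_norm (\<lambda>z. h z - f z)
        \<le> sqrt ((L2_norm (\<lambda>z. h z - v z))\<^sup>2 + inverse (real (Suc n))) + L2_norm (\<lambda>z. u n z - f z)"
      by blast
  qed
  with f show ?thesis by (rule that)
qed

lemma bergman_projection_exists:
  assumes h: "h \<in> L2"
  shows "\<exists>f. f \<in> bergman \<and> (\<forall>u\<in>bergman. L2_inner (\<lambda>z. h z - f z) u = 0)"
proof -
  obtain f where f: "f \<in> bergman"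
    and best: "\<And>u. u \<in> bergman \<Longrightarrow> L2_norm (\<lambda>z. h z - f z) \<le> L2_norm (\<lambda>z. h z - u z)"
    using bergman_best_approximation[OF h] by blast
  have hf: "(\<lambda>z. h z - f z) \<in> L2"
    by (rule L2_diff[OF h bergmanD(1)[OF f]])
  have "L2_inner (\<lambda>z. h z - f z) u = 0" if u: "u \<in> bergman" for u
  proof (rule ccontr)
    define t where "t = L2_inner (\<lambda>z. h z - f z) u"
    assume "L2_inner (\<lambda>z. h z - f z) u \<noteq> 0"
    then have t: "t \<noteq> 0" by (simp add: t_def)
    \<comment> \<open>Moving from \<open>f\<close> by \<open>s * t * u\<close> would bring it closer to \<open>h\<close>; the choice of \<open>s\<close> makes the
      quadratic term smaller than the linear gain.\<close>
    define s where "s = 1 / ((L2_norm u)\<^sup>2 + 1)"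
    have pos: "(L2_norm u)\<^sup>2 + 1 > 0" by (simp add: add_nonneg_pos)
    have s: "s > 0" "s * (L2_norm u)\<^sup>2 < 1"
      using pos by (auto simp: s_def field_simps)
    define v where "v z = f z + of_real s * t * u z" for z
    have tu: "(\<lambda>z. of_real s * t * u z) \<in> L2"
      using L2_scale[OF bergmanD(1)[OF u], of "of_real s * t"] by (simp add: mult.assoc)
    have "v \<in> bergman"
      unfolding v_def using bergman_add[OF f bergman_scale[OF u, of "of_real s * t"]] by (simp add: mult.assoc)
    then have "(L2_norm (\<lambda>z. h z - f z))\<^sup>2 \<le> (L2_norm (\<lambda>z. h z - v z))\<^sup>2"
      by (intro power_mono best) auto
    also have "L2_norm (\<lambda>z. h z - v z) = L2_norm (\<lambda>z. (h z - f z) - of_real s * t * u z)"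
      by (simp add: v_def diff_diff_eq)
    also have "\<dots>\<^sup>2 = (L2_norm (\<lambda>z. h z - f z))\<^sup>2 - 2 * Re (L2_inner (\<lambda>z. h z - f z) (\<lambda>z. of_real s * t * u z))
        + (L2_norm (\<lambda>z. of_real s * t * u z))\<^sup>2"
      by (rule L2_norm_diff_square[OF hf tu])
    also have "L2_inner (\<lambda>z. h z - f z) (\<lambda>z. of_real s * t * u z) = of_real (s * (cmod t)\<^sup>2)"
      unfolding L2_inner_scale_right t_def[symmetric] of_real_mult complex_norm_square by simp
    also have "(L2_norm (\<lambda>z. of_real s * t * u z))\<^sup>2 = s * (cmod t)\<^sup>2 * (s * (L2_norm u)\<^sup>2)"
      unfolding L2_norm_scale by (simp add: norm_mult power_mult_distrib power2_eq_square)
    finally have "2 * (s * (cmod t)\<^sup>2) \<le> s * (cmod t)\<^sup>2 * (s * (L2_norm u)\<^sup>2)"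
      by simp
    moreover have "s * (cmod t)\<^sup>2 * (s * (L2_norm u)\<^sup>2) < s * (cmod t)\<^sup>2 * 1"
      using s t by (intro mult_strict_left_mono) auto
    moreover have "0 < s * (cmod t)\<^sup>2"
      using s t by simp
    ultimately show False by linarith
  qed
  with f show ?thesis by blast
qed

text \<open>
  The defining property characterizes the projection, so the definite description is meaningful;
  two candidates differ by a Bergman function orthogonal to itself.
\<close>
lemma bergman_proj_unique:
  assumes h: "h \<in> L2" and f: "f \<in> bergman" "\<And>u. u \<in> bergman \<Longrightarrow> L2_inner (\<lambda>z. h z - f z) u = 0"
  shows "bergman_proj h = f"
  unfolding bergman_proj_def
proof (rule the_equality)
  show "f \<in> bergman \<and> (\<forall>u\<in>bergman. L2_inner (\<lambda>z. h z - f z) u = 0)"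
    using f by blast
  fix f' assume f': "f' \<in> bergman \<and> (\<forall>u\<in>bergman. L2_inner (\<lambda>z. h z - f' z) u = 0)"
  have diff: "(\<lambda>z. f' z - f z) \<in> bergman"
    using f' f by (intro bergman_diff) auto
  have "L2_inner (\<lambda>z. f' z - f z) (\<lambda>z. f' z - f z)
      = L2_inner (\<lambda>z. (h z - f z) - (h z - f' z)) (\<lambda>z. f' z - f z)"
    by simp
  also have "\<dots> = L2_inner (\<lambda>z. h z - f z) (\<lambda>z. f' z - f z) - L2_inner (\<lambda>z. h z - f' z) (\<lambda>z. f' z - f z)"
    by (rule L2_inner_diff_left[OF L2_diff[OF h bergmanD(1)[OF f(1)]] L2_diff[OF h bergmanD(1)[OF conjunct1[OF f']]] bergmanD(1)[OF diff]])
  also have "\<dots> = 0"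
    using f' f(2) diff by simp
  finally have "L2_norm (\<lambda>z. f' z - f z) = 0"
    by (simp add: L2_inner_self)
  then show "f' = f"
    using bergman_norm_eq_0[OF diff] by (intro ext) simp
qed

lemma
  assumes h: "h \<in> L2"
  shows bergman_proj_bergman: "bergman_proj h \<in> bergman"
    and bergman_proj_orthogonal: "\<And>u. u \<in> bergman \<Longrightarrow> L2_inner (\<lambda>z. h z - bergman_proj h z) u = 0"
  using bergman_projection_exists[OF h] bergman_proj_unique[OF h] by metis+

lemma bergman_proj_inner:
  assumes h: "h \<in> L2" and u: "u \<in> bergman"
  shows "L2_inner (bergman_proj h) u = L2_inner h u"
  using bergman_proj_orthogonal[OF h u] 
    L2_inner_diff_left[OF h bergmanD(1)[OF bergman_proj_bergman[OF h]] bergmanD(1)[OF u]] by simp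

lemma bergman_proj_norm_le:
  assumes h: "h \<in> L2"
  shows "L2_norm (bergman_proj h) \<le> L2_norm h"
proof -
  let ?p = "bergman_proj h"
  have p: "?p \<in> bergman" by (rule bergman_proj_bergman[OF h])
  have "(L2_norm ?p)\<^sup>2 = cmod (L2_inner h ?p)"
    unfolding bergman_proj_inner[OF h p, symmetric] L2_inner_self norm_of_real by simp
  also have "\<dots> \<le> L2_norm h * L2_norm ?p"
    by (rule L2_Cauchy_Schwarz[OF h bergmanD(1)[OF p]])
  finally have "L2_norm ?p * L2_norm ?p \<le> L2_norm h * L2_norm ?p"
    by (simp add: power2_eq_square)
  then show ?thesis
    using L2_norm_nonneg[of ?p] by (cases "L2_norm ?p = 0") (auto dest: mult_right_le_imp_le simp: less_le)
qed

lemma bergman_proj_id: "f \<in> bergman \<Longrightarrow> bergman_proj f = f"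
  by (rule bergman_proj_unique) (auto simp: bergmanD L2_inner_def)

section \<open>Algebra of Toeplitz operators\<close>

text \<open>
  The bound is demanded at every point of the disc rather than almost everywhere, and it is kept as
  an argument because it also bounds the norm of the Toeplitz operator.
\<close>
definition bounded_symbol :: "(complex \<Rightarrow> complex) \<Rightarrow> real \<Rightarrow> bool" where
  "bounded_symbol \<psi> M \<longleftrightarrow> \<psi> \<in> borel_measurable area \<and> (\<forall>z\<in>unit_disc. cmod (\<psi> z) \<le> M)"

lemma bounded_symbol_mult_L2:
  "bounded_symbol \<psi> M \<Longrightarrow> f \<in> L2 \<Longrightarrow> (\<lambda>z. \<psi> z * f z) \<in> L2"
  by (auto simp: bounded_symbol_def intro: L2_mult_bounded(1))

lemma toeplitz_cong:
  assumes "\<And>z. z \<in> unit_disc \<Longrightarrow> \<psi> z = \<rho> z" "f \<in> bergman"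
  shows "toeplitz \<psi> f = toeplitz \<rho> f"
proof -
  have "(\<lambda>z. \<psi> z * f z) = (\<lambda>z. \<rho> z * f z)"
  proof
    show "\<psi> z * f z = \<rho> z * f z" for z
      using assms(1)[of z] bergmanD(3)[OF assms(2), of z] by (cases "z \<in> unit_disc") auto
  qed
  then show ?thesis by (simp add: toeplitz_def)
qed

context
  fixes \<psi> M
  assumes \<psi>: "bounded_symbol \<psi> M"
begin

lemma toeplitz_bergman: "f \<in> bergman \<Longrightarrow> toeplitz \<psi> f \<in> bergman"
  unfolding toeplitz_def by (intro bergman_proj_bergman bounded_symbol_mult_L2[OF \<psi>] bergmanD)

lemma toeplitz_inner:
  "f \<in> bergman \<Longrightarrow> u \<in> bergman \<Longrightarrow> L2_inner (toeplitz \<psi> f) u = L2_inner (\<lambda>z. \<psi> z * f z) u"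
  unfolding toeplitz_def by (intro bergman_proj_inner bounded_symbol_mult_L2[OF \<psi>] bergmanD)

lemma toeplitz_norm_le_mult: "f \<in> bergman \<Longrightarrow> L2_norm (toeplitz \<psi> f) \<le> L2_norm (\<lambda>z. \<psi> z * f z)"
  unfolding toeplitz_def by (intro bergman_proj_norm_le bounded_symbol_mult_L2[OF \<psi>] bergmanD)

lemma toeplitz_norm_le: "f \<in> bergman \<Longrightarrow> L2_norm (toeplitz \<psi> f) \<le> M * L2_norm f"
  using toeplitz_norm_le_mult[of f] L2_mult_bounded(2)[of \<psi> M f] \<psi> bergmanD(1)[of f]
  by (force simp: bounded_symbol_def)

lemma toeplitz_add:
  assumes f: "f \<in> bergman" and h: "h \<in> bergman"
  shows "toeplitz \<psi> (\<lambda>z. f z + h z) = (\<lambda>z. toeplitz \<psi> f z + toeplitz \<psi> h z)"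
proof (rule bergman_eqI_inner)
  fix u assume u: "u \<in> bergman"
  have "L2_inner (\<lambda>z. \<psi> z * (f z + h z)) u = L2_inner (\<lambda>z. \<psi> z * f z) u + L2_inner (\<lambda>z. \<psi> z * h z) u"
    using L2_inner_add_left[of "\<lambda>z. \<psi> z * f z" "\<lambda>z. \<psi> z * h z" u] f h u
    by (simp add: ring_distribs bergmanD bounded_symbol_mult_L2[OF \<psi>])
  then show "L2_inner (toeplitz \<psi> (\<lambda>z. f z + h z)) u = L2_inner (\<lambda>z. toeplitz \<psi> f z + toeplitz \<psi> h z) u"
    using f h u by (simp add: toeplitz_inner toeplitz_bergman bergman_add bergmanD L2_inner_add_left)
qed (use f h in \<open>simp_all add: toeplitz_bergman bergman_add\<close>)

lemma toeplitz_scale: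
  assumes f: "f \<in> bergman"
  shows "toeplitz \<psi> (\<lambda>z. a * f z) = (\<lambda>z. a * toeplitz \<psi> f z)"
proof (rule bergman_eqI_inner)
  fix u assume u: "u \<in> bergman"
  show "L2_inner (toeplitz \<psi> (\<lambda>z. a * f z)) u = L2_inner (\<lambda>z. a * toeplitz \<psi> f z) u"
    using f u L2_inner_scale_left[of a "\<lambda>z. \<psi> z * f z" u]
    by (simp add: toeplitz_inner bergman_scale L2_inner_scale_left mult.left_commute)
qed (use f in \<open>simp_all add: toeplitz_bergman bergman_scale\<close>)

lemma toeplitz_bounded_operator: "bergman_bounded_operator (toeplitz \<psi>)"
  unfolding bergman_bounded_operator_def
  using toeplitz_bergman toeplitz_add toeplitz_scale toeplitz_norm_le by blast

end

lemma toeplitz_H_infinity: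
  assumes "g \<in> H_infinity" "f \<in> bergman"
  shows "toeplitz g f = (\<lambda>z. g z * f z)"
  unfolding toeplitz_def using assms by (intro bergman_proj_id bergman_mult_H_infinity)

lemma toeplitz_mult_analytic:
  assumes "g \<in> H_infinity" "f \<in> bergman"
  shows "toeplitz \<psi> (toeplitz g f) = toeplitz (\<lambda>z. \<psi> z * g z) f"
  unfolding toeplitz_H_infinity[OF assms] by (simp add: toeplitz_def mult.assoc)

lemma H_infinity_symbol:
  assumes "g \<in> H_infinity"
  obtains M where "bounded_symbol g M" "bounded_symbol (\<lambda>z. cnj (g z)) M" "M > 0"
proof -
  obtain M where "\<And>z. z \<in> unit_disc \<Longrightarrow> cmod (g z) \<le> M" "M > 0"
    using H_infinity_bound[OF assms] by blast
  then show ?thesis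
    using H_infinity_measurable[OF assms] measurable_compose[OF H_infinity_measurable[OF assms] cnj_measurable]
    by (intro that[of M]) (auto simp: bounded_symbol_def)
qed

lemma inner_cnj_mult: "L2_inner (\<lambda>z. cnj (g z) * f z) u = L2_inner f (\<lambda>z. g z * u z)"
  by (simp add: L2_inner_def mult_ac)

text \<open>
  Multiplication by \<open>cnj \<circ> g\<close> is adjoint to multiplication by \<open>g\<close>, which preserves the Bergman space.
  So it does not see what the inner projection discards.
\<close>
lemma toeplitz_mult_coanalytic:
  assumes g: "g \<in> H_infinity" and \<psi>: "bounded_symbol \<psi> M" and f: "f \<in> bergman"
  shows "toeplitz (\<lambda>z. cnj (g z)) (toeplitz \<psi> f) = toeplitz (\<lambda>z. cnj (g z) * \<psi> z) f"
proof -
  obtain K where K: "bounded_symbol (\<lambda>z. cnj (g z)) K" "K > 0"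
    using H_infinity_symbol[OF g] by blast
  have prod: "bounded_symbol (\<lambda>z. cnj (g z) * \<psi> z) (K * M)"
    using K \<psi> by (auto simp: bounded_symbol_def norm_mult intro!: mult_mono)
  show ?thesis
  proof (rule bergman_eqI_inner)
    fix u assume u: "u \<in> bergman"
    have gu: "(\<lambda>z. g z * u z) \<in> bergman"
      by (rule bergman_mult_H_infinity[OF g u])
    have "L2_inner (toeplitz (\<lambda>z. cnj (g z)) (toeplitz \<psi> f)) u = L2_inner (toeplitz \<psi> f) (\<lambda>z. g z * u z)"
      using f u by (simp add: toeplitz_inner[OF K(1)] toeplitz_bergman[OF \<psi>] inner_cnj_mult)
    also have "\<dots> = L2_inner (\<lambda>z. cnj (g z) * (\<psi> z * f z)) u"
      by (simp add: toeplitz_inner[OF \<psi> f gu] inner_cnj_mult)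
    also have "\<dots> = L2_inner (toeplitz (\<lambda>z. cnj (g z) * \<psi> z) f) u"
      by (simp add: toeplitz_inner[OF prod f u] mult.assoc)
    finally show "L2_inner (toeplitz (\<lambda>z. cnj (g z)) (toeplitz \<psi> f)) u = L2_inner (toeplitz (\<lambda>z. cnj (g z) * \<psi> z) f) u" .
  qed (use f in \<open>simp_all add: toeplitz_bergman[OF K(1)] toeplitz_bergman[OF \<psi>] toeplitz_bergman[OF prod]\<close>)
qed

text \<open>
  Testing against \<open>u\<close> and moving \<open>cnj \<circ> g\<close> to the other side evaluates \<open>g * u\<close> at \<open>z\<close>, which is a product.
\<close>
lemma toeplitz_cnj_kernel:
  assumes g: "g \<in> H_infinity" and z: "z \<in> unit_disc"
  shows "toeplitz (\<lambda>w. cnj (g w)) (bergman_kernel z) = (\<lambda>w. cnj (g z) * bergman_kernel z w)"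
proof -
  obtain K where K: "bounded_symbol (\<lambda>z. cnj (g z)) K"
    using H_infinity_symbol[OF g] by blast
  have k: "bergman_kernel z \<in> bergman"
    by (rule bergman_kernel_bergman[OF z])
  show ?thesis
  proof (rule bergman_eqI_inner)
    fix u assume u: "u \<in> bergman"
    have rep: "L2_inner (bergman_kernel z) v = cnj (v z)" if "v \<in> bergman" for v
      using bergman_reproducing[OF that z] L2_inner_commute[of "bergman_kernel z" v] by simp
    have "L2_inner (toeplitz (\<lambda>w. cnj (g w)) (bergman_kernel z)) u
        = L2_inner (bergman_kernel z) (\<lambda>w. g w * u w)"
      unfolding toeplitz_inner[OF K k u] by (rule inner_cnj_mult)
    also have "\<dots> = cnj (g z) * L2_inner (bergman_kernel z) u"
      using rep[OF bergman_mult_H_infinity[OF g u]] rep[OF u] by simp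
    finally show "L2_inner (toeplitz (\<lambda>w. cnj (g w)) (bergman_kernel z)) u
        = L2_inner (\<lambda>w. cnj (g z) * bergman_kernel z w) u"
      by (simp add: L2_inner_scale_left)
  qed (use k in \<open>simp_all add: toeplitz_bergman[OF K] bergman_scale\<close>)
qed

lemma toeplitz_add_symbol:
  assumes \<psi>: "bounded_symbol \<psi> M" and \<rho>: "bounded_symbol \<rho> K" and f: "f \<in> bergman"
  shows "toeplitz (\<lambda>z. \<psi> z + \<rho> z) f = (\<lambda>z. toeplitz \<psi> f z + toeplitz \<rho> f z)"
proof -
  have sum: "bounded_symbol (\<lambda>z. \<psi> z + \<rho> z) (M + K)"
    using \<psi> \<rho> by (auto simp: bounded_symbol_def intro!: order_trans[OF norm_triangle_ineq] add_mono)
  show ?thesis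
  proof (rule bergman_eqI_inner)
    fix u assume u: "u \<in> bergman"
    have "L2_inner (\<lambda>z. (\<psi> z + \<rho> z) * f z) u = L2_inner (\<lambda>z. \<psi> z * f z) u + L2_inner (\<lambda>z. \<rho> z * f z) u"
      unfolding distrib_right
      by (intro L2_inner_add_left bounded_symbol_mult_L2[OF \<psi>] bounded_symbol_mult_L2[OF \<rho>] bergmanD(1) f u)
    then show "L2_inner (toeplitz (\<lambda>z. \<psi> z + \<rho> z) f) u = L2_inner (\<lambda>z. toeplitz \<psi> f z + toeplitz \<rho> f z) u"
      using f u by (simp add: toeplitz_inner[OF \<psi>] toeplitz_inner[OF \<rho>] toeplitz_inner[OF sum]
          toeplitz_bergman[OF \<psi>] toeplitz_bergman[OF \<rho>] bergmanD L2_inner_add_left)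
  qed (use f in \<open>simp_all add: toeplitz_bergman[OF \<psi>] toeplitz_bergman[OF \<rho>] toeplitz_bergman[OF sum] bergman_add\<close>)
qed

lemma toeplitz_const: "f \<in> bergman \<Longrightarrow> toeplitz (\<lambda>_. a) f = (\<lambda>z. a * f z)"
  by (rule toeplitz_H_infinity[OF const_H_infinity])

section \<open>Invertible operators on the Bergman space\<close>

lemma bergman_bounded_operatorI:
  assumes "\<And>f. f \<in> bergman \<Longrightarrow> T f \<in> bergman"
    and "\<And>f h. f \<in> bergman \<Longrightarrow> h \<in> bergman \<Longrightarrow> T (\<lambda>z. f z + h z) = (\<lambda>z. T f z + T h z)"
    and "\<And>f a. f \<in> bergman \<Longrightarrow> T (\<lambda>z. a * f z) = (\<lambda>z. a * T f z)"
    and "\<And>f. f \<in> bergman \<Longrightarrow> L2_norm (T f) \<le> C * L2_norm f"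
  shows "bergman_bounded_operator T"
  using assms unfolding bergman_bounded_operator_def by blast

lemma bergman_bounded_operatorD:
  assumes "bergman_bounded_operator T"
  shows "f \<in> bergman \<Longrightarrow> T f \<in> bergman"
    and "f \<in> bergman \<Longrightarrow> h \<in> bergman \<Longrightarrow> T (\<lambda>z. f z + h z) = (\<lambda>z. T f z + T h z)"
    and "f \<in> bergman \<Longrightarrow> T (\<lambda>z. a * f z) = (\<lambda>z. a * T f z)"
  using assms unfolding bergman_bounded_operator_def by blast+

lemma bergman_bounded_operator_bound:
  assumes "bergman_bounded_operator T"
  obtains C where "C > 0" "\<And>f. f \<in> bergman \<Longrightarrow> L2_norm (T f) \<le> C * L2_norm f"
proof -
  obtain C where C: "\<forall>f\<in>bergman. L2_norm (T f) \<le> C * L2_norm f"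
    using assms unfolding bergman_bounded_operator_def by blast
  have "L2_norm (T f) \<le> max C 1 * L2_norm f" if "f \<in> bergman" for f
    using bspec[OF C that] mult_right_mono[of C "max C 1" "L2_norm f"] by simp
  then show ?thesis by (intro that[of "max C 1"]) auto
qed

lemma bergman_bounded_operator_comp:
  assumes A: "bergman_bounded_operator A" and B: "bergman_bounded_operator B"
  shows "bergman_bounded_operator (\<lambda>f. A (B f))"
proof -
  obtain CA where CA: "CA > 0" "\<And>f. f \<in> bergman \<Longrightarrow> L2_norm (A f) \<le> CA * L2_norm f"
    using bergman_bounded_operator_bound[OF A] by blast
  obtain CB where CB: "\<And>f. f \<in> bergman \<Longrightarrow> L2_norm (B f) \<le> CB * L2_norm f"
    using bergman_bounded_operator_bound[OF B] by blast
  have "L2_norm (A (B f)) \<le> (CA * CB) * L2_norm f" if f: "f \<in> bergman" for f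
  proof -
    have "L2_norm (A (B f)) \<le> CA * L2_norm (B f)"
      by (rule CA(2)[OF bergman_bounded_operatorD(1)[OF B f]])
    also have "\<dots> \<le> CA * (CB * L2_norm f)"
      using CA(1) CB[OF f] by (intro mult_left_mono) auto
    finally show ?thesis by (simp add: mult.assoc)
  qed
  then show ?thesis
    by (rule bergman_bounded_operatorI[rotated 3])
      (simp_all add: bergman_bounded_operatorD[OF A] bergman_bounded_operatorD[OF B])
qed

lemma bergman_bounded_operator_cong:
  assumes eq: "\<And>f. f \<in> bergman \<Longrightarrow> T f = T' f" and T: "bergman_bounded_operator T"
  shows "bergman_bounded_operator T'"
proof -
  obtain C where "\<And>f. f \<in> bergman \<Longrightarrow> L2_norm (T f) \<le> C * L2_norm f"
    using bergman_bounded_operator_bound[OF T] by blast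
  then show ?thesis
    using eq[symmetric] bergman_bounded_operatorD[OF T]
    by (intro bergman_bounded_operatorI[where C = C]) (simp_all add: bergman_add bergman_scale)
qed

lemma bergman_invertible_cong:
  assumes eq: "\<And>f. f \<in> bergman \<Longrightarrow> T f = T' f"
  shows "bergman_invertible T \<longleftrightarrow> bergman_invertible T'"
proof -
  have "bergman_invertible T'" if eq: "\<And>f. f \<in> bergman \<Longrightarrow> T f = T' f" and "bergman_invertible T" for T T'
  proof -
    from that(2) obtain S where S: "bergman_bounded_operator T" "bergman_bounded_operator S"
      "\<And>f. f \<in> bergman \<Longrightarrow> S (T f) = f \<and> T (S f) = f"
      unfolding bergman_invertible_def by blast
    have "S (T' f) = f \<and> T' (S f) = f" if "f \<in> bergman" for f
    proof -
      have "S f \<in> bergman" by (rule bergman_bounded_operatorD(1)[OF S(2) that])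
      then show ?thesis using S(3)[OF that] eq[OF that] eq[of "S f"] by simp
    qed
    with S bergman_bounded_operator_cong[OF eq S(1)] show ?thesis
      unfolding bergman_invertible_def by blast
  qed
  from this[of T T'] this[of T' T] eq show ?thesis by auto
qed

lemma bergman_invertible_inverse:
  assumes "bergman_invertible T"
  obtains S where "bergman_invertible S" "\<And>f. f \<in> bergman \<Longrightarrow> S f \<in> bergman"
    "\<And>f. f \<in> bergman \<Longrightarrow> S (T f) = f" "\<And>f. f \<in> bergman \<Longrightarrow> T (S f) = f"
proof -
  obtain S where S: "bergman_bounded_operator S" "\<forall>f\<in>bergman. S (T f) = f \<and> T (S f) = f"
    using assms unfolding bergman_invertible_def by blast
  moreover have "bergman_bounded_operator T"
    using assms unfolding bergman_invertible_def by blast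
  ultimately have "bergman_invertible S"
    unfolding bergman_invertible_def by blast
  then show ?thesis
    using S bergman_bounded_operatorD(1)[OF S(1)] by (intro that[of S]) blast+
qed

lemma bergman_invertible_comp:
  assumes A: "bergman_invertible A" and B: "bergman_invertible B"
  shows "bergman_invertible (\<lambda>f. A (B f))"
proof -
  obtain S where S: "bergman_bounded_operator S" "\<And>f. f \<in> bergman \<Longrightarrow> S (A f) = f \<and> A (S f) = f"
    using A unfolding bergman_invertible_def by blast
  obtain R where R: "bergman_bounded_operator R" "\<And>f. f \<in> bergman \<Longrightarrow> R (B f) = f \<and> B (R f) = f"
    using B unfolding bergman_invertible_def by blast
  have AB: "bergman_bounded_operator A" "bergman_bounded_operator B"
    using A B by (auto simp: bergman_invertible_def)
  have "R (S (A (B f))) = f \<and> A (B (R (S f))) = f" if "f \<in> bergman" for f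
  proof -
    have "B f \<in> bergman" "S f \<in> bergman"
      using bergman_bounded_operatorD(1) AB S(1) that by blast+
    then show ?thesis using S(2) R(2) that by simp
  qed
  then show ?thesis
    using bergman_bounded_operator_comp[OF AB] bergman_bounded_operator_comp[OF R(1) S(1)]
    unfolding bergman_invertible_def by (intro conjI exI[of _ "\<lambda>f. R (S f)"]) auto
qed

lemma bergman_invertible_comp_iff_inner:
  assumes A: "bergman_invertible A" and B: "\<And>f. f \<in> bergman \<Longrightarrow> B f \<in> bergman"
  shows "bergman_invertible (\<lambda>f. A (B f)) \<longleftrightarrow> bergman_invertible B"
proof
  obtain S where S: "bergman_invertible S" "\<And>f. f \<in> bergman \<Longrightarrow> S f \<in> bergman"
      "\<And>f. f \<in> bergman \<Longrightarrow> S (A f) = f" "\<And>f. f \<in> bergman \<Longrightarrow> A (S f) = f"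
    using bergman_invertible_inverse[OF A] by metis
  assume AB: "bergman_invertible (\<lambda>f. A (B f))"
  have "bergman_invertible (\<lambda>f. S (A (B f))) \<longleftrightarrow> bergman_invertible B"
    by (rule bergman_invertible_cong) (simp add: S(3) B)
  then show "bergman_invertible B"
    using bergman_invertible_comp[OF S(1) AB] by simp
next
  show "bergman_invertible (\<lambda>f. A (B f))" if "bergman_invertible B"
    by (rule bergman_invertible_comp[OF A that])
qed

lemma bergman_invertible_comp_iff_outer:
  assumes B: "bergman_invertible B"
  shows "bergman_invertible (\<lambda>f. A (B f)) \<longleftrightarrow> bergman_invertible A"
proof
  obtain S where S: "bergman_invertible S" "\<And>f. f \<in> bergman \<Longrightarrow> S f \<in> bergman"
      "\<And>f. f \<in> bergman \<Longrightarrow> S (B f) = f" "\<And>f. f \<in> bergman \<Longrightarrow> B (S f) = f"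
    using bergman_invertible_inverse[OF B] by metis
  assume AB: "bergman_invertible (\<lambda>f. A (B f))"
  have "bergman_invertible (\<lambda>f. A (B (S f))) \<longleftrightarrow> bergman_invertible A"
    by (rule bergman_invertible_cong) (simp add: S(4))
  then show "bergman_invertible A"
    using bergman_invertible_comp[OF AB S(1)] by simp
next
  show "bergman_invertible (\<lambda>f. A (B f))" if "bergman_invertible A"
    by (rule bergman_invertible_comp[OF that B])
qed

lemma bergman_invertible_bounded_below:
  assumes "bergman_invertible T"
  obtains C where "C > 0" "\<And>f. f \<in> bergman \<Longrightarrow> L2_norm f \<le> C * L2_norm (T f)"
proof -
  obtain S where S: "bergman_bounded_operator S" "\<forall>f\<in>bergman. S (T f) = f \<and> T (S f) = f"
    and T: "bergman_bounded_operator T"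
    using assms unfolding bergman_invertible_def by blast
  obtain C where "C > 0" and C: "\<And>f. f \<in> bergman \<Longrightarrow> L2_norm (S f) \<le> C * L2_norm f"
    using bergman_bounded_operator_bound[OF S(1)] by blast
  have "L2_norm f \<le> C * L2_norm (T f)" if "f \<in> bergman" for f
    using C[OF bergman_bounded_operatorD(1)[OF T that]] S(2) that by simp
  with \<open>C > 0\<close> show ?thesis by (rule that)
qed

lemma bergman_invertibleI:
  assumes T: "bergman_bounded_operator T" and e: "e > 0"
    and below: "\<And>f. f \<in> bergman \<Longrightarrow> e * L2_norm f \<le> L2_norm (T f)"
    and surj: "\<And>h. h \<in> bergman \<Longrightarrow> \<exists>f\<in>bergman. T f = h"
  shows "bergman_invertible T"
proof -
  note T_in = bergman_bounded_operatorD(1)[OF T] and T_add = bergman_bounded_operatorD(2)[OF T]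
    and T_scale = bergman_bounded_operatorD(3)[OF T]
  have inj: "f = h" if fh: "f \<in> bergman" "h \<in> bergman" and eq: "T f = T h" for f h
  proof -
    let ?d = "\<lambda>z. f z + (-1) * h z"
    have d: "?d \<in> bergman" using fh by (intro bergman_add bergman_scale)
    have "T ?d = (\<lambda>z. 0)"
      using T_add[OF fh(1) bergman_scale[OF fh(2), of "-1"]] T_scale[OF fh(2), of "-1"] eq by simp
    then have "e * L2_norm ?d \<le> 0"
      using below[OF d] by (simp add: L2_norm_def)
    then have "L2_norm ?d \<le> 0"
      using e by (simp add: mult_le_0_iff)
    then have "L2_norm ?d = 0"
      by (rule antisym) simp
    then show ?thesis
      using bergman_norm_eq_0[OF d] by (intro ext) simp
  qed
  obtain S where S_in: "\<And>h. h \<in> bergman \<Longrightarrow> S h \<in> bergman" and TS: "\<And>h. h \<in> bergman \<Longrightarrow> T (S h) = h"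
    using surj by metis
  have "bergman_bounded_operator S"
  proof (rule bergman_bounded_operatorI)
    fix f h a assume f: "f \<in> bergman"
    show "S f \<in> bergman" by (rule S_in[OF f])
    show "S (\<lambda>z. a * f z) = (\<lambda>z. a * S f z)"
      by (rule inj[OF S_in[OF bergman_scale[OF f]] bergman_scale[OF S_in[OF f]]])
        (simp only: TS[OF bergman_scale[OF f]] T_scale[OF S_in[OF f]] TS[OF f])
    show "L2_norm (S f) \<le> (1 / e) * L2_norm f"
      using below[OF S_in[OF f]] TS[OF f] e by (simp add: field_simps)
    assume h: "h \<in> bergman"
    show "S (\<lambda>z. f z + h z) = (\<lambda>z. S f z + S h z)"
      by (rule inj[OF S_in[OF bergman_add[OF f h]] bergman_add[OF S_in[OF f] S_in[OF h]]])
        (simp only: TS[OF bergman_add[OF f h]] T_add[OF S_in[OF f] S_in[OF h]] TS[OF f] TS[OF h])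
  qed
  moreover have "S (T f) = f \<and> T (S f) = f" if "f \<in> bergman" for f
    using inj[OF S_in[OF T_in[OF that]] that TS[OF T_in[OF that]]] TS[OF that] by blast
  ultimately show ?thesis
    using T unfolding bergman_invertible_def by blast
qed

section \<open>Symbols close to a constant\<close>

lemma bergman_Metric_space: "Metric_space bergman (\<lambda>f h. L2_norm (\<lambda>z. f z - h z))"
proof
  fix f g h assume fgh: "f \<in> bergman" "g \<in> bergman" "h \<in> bergman"
  show "L2_norm (\<lambda>z. f z - h z) \<le> L2_norm (\<lambda>z. f z - g z) + L2_norm (\<lambda>z. g z - h z)"
    using fgh by (intro L2_norm_triangle_diff bergmanD(1))
next
  fix f h assume fh: "f \<in> bergman" "h \<in> bergman"
  show "L2_norm (\<lambda>z. f z - h z) = 0 \<longleftrightarrow> f = h"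
  proof
    assume "L2_norm (\<lambda>z. f z - h z) = 0"
    then have "f z - h z = 0" for z
      by (rule bergman_norm_eq_0[OF bergman_diff[OF fh]])
    then show "f = h" by (intro ext) simp
  qed (simp add: L2_norm_def)
qed (auto intro: L2_norm_minus_commute)

lemma bergman_mcomplete: "Metric_space.mcomplete bergman (\<lambda>f h. L2_norm (\<lambda>z. f z - h z))"
proof -
  interpret Metric_space bergman "\<lambda>f h. L2_norm (\<lambda>z. f z - h z)"
    by (rule bergman_Metric_space)
  show ?thesis
    unfolding mcomplete_def
  proof (intro allI impI)
    fix u assume M: "MCauchy u"
    have u: "u n \<in> bergman" for n
      using M unfolding MCauchy_def by blast
    have Cauchy: "\<exists>N. \<forall>n\<ge>N. \<forall>m\<ge>N. L2_norm (\<lambda>z. u n z - u m z) < e" if "e > 0" for e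
    proof -
      have "\<forall>\<epsilon>>0. \<exists>N. \<forall>n n'. N \<le> n \<longrightarrow> N \<le> n' \<longrightarrow> L2_norm (\<lambda>z. u n z - u n' z) < \<epsilon>"
        using M unfolding MCauchy_def by (rule conjunct2)
      then show ?thesis using that by blast
    qed
    obtain f where "f \<in> bergman" "(\<lambda>n. L2_norm (\<lambda>z. u n z - f z)) \<longlonglongrightarrow> 0"
      by (rule bergman_complete[of u, OF u Cauchy])
    then have "limitin mtopology u f sequentially"
      using u order_tendstoD(2)[of _ 0 sequentially] by (auto simp: limit_metric_sequentially eventually_sequentially)
    then show "\<exists>f. limitin mtopology u f sequentially" by blast
  qed
qed

text \<open>
  The operator is \<open>a\<close> times the identity plus an operator of norm at most \<open>q < cmod a\<close>. Surjectivity is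
  the contraction principle applied to \<open>f \<mapsto> (h - R f) / a\<close>.
\<close>
lemma toeplitz_near_constant_invertible:
  assumes near: "bounded_symbol (\<lambda>z. \<psi> z - a) q" and q: "q < cmod a"
  shows "bergman_invertible (toeplitz \<psi>)"
proof -
  define R where "R = toeplitz (\<lambda>z. \<psi> z - a)"
  have a0: "a \<noteq> 0" and q0: "0 \<le> q"
  proof -
    have "cmod (\<psi> 0 - a) \<le> q" using near by (simp add: bounded_symbol_def)
    then show "0 \<le> q" using norm_ge_zero order_trans by blast
    with q show "a \<noteq> 0" by auto
  qed
  have const: "bounded_symbol (\<lambda>_. a) (cmod a)"
    by (simp add: bounded_symbol_def)
  have \<psi>: "bounded_symbol \<psi> (q + cmod a)"
  proof -
    have "(\<lambda>z. (\<psi> z - a) + a) \<in> borel_measurable area"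
      using near by (intro borel_measurable_add) (auto simp: bounded_symbol_def)
    moreover have "cmod (\<psi> z) \<le> q + cmod a" if "z \<in> unit_disc" for z
      using near that norm_triangle_ineq[of "\<psi> z - a" a] by (force simp: bounded_symbol_def)
    ultimately show ?thesis by (simp add: bounded_symbol_def)
  qed
  have R_in: "R f \<in> bergman" and R_le: "L2_norm (R f) \<le> q * L2_norm f" if "f \<in> bergman" for f
    unfolding R_def using that toeplitz_bergman[OF near] toeplitz_norm_le[OF near] by auto
  have T_eq: "toeplitz \<psi> f = (\<lambda>z. R f z + a * f z)" if "f \<in> bergman" for f
    using toeplitz_add_symbol[OF near const that] toeplitz_const[OF that] by (simp add: R_def)
  have R_diff: "R (\<lambda>z. f z - h z) = (\<lambda>z. R f z - R h z)" if "f \<in> bergman" "h \<in> bergman" for f h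
    using toeplitz_add[OF near that(1) bergman_scale[OF that(2), of "-1"]] toeplitz_scale[OF near that(2), of "-1"]
    by (simp add: R_def)
  show ?thesis
  proof (rule bergman_invertibleI[OF toeplitz_bounded_operator[OF \<psi>]])
    show "0 < cmod a - q" using q by simp
    fix f assume f: "f \<in> bergman"
    have "L2_norm (\<lambda>z. a * f z) = L2_norm (\<lambda>z. toeplitz \<psi> f z + (-1) * R f z)"
      by (simp add: T_eq[OF f])
    also have "\<dots> \<le> L2_norm (toeplitz \<psi> f) + L2_norm (\<lambda>z. (-1) * R f z)"
      using f by (intro L2_norm_triangle L2_scale bergmanD(1) R_in toeplitz_bergman[OF \<psi>])
    finally show "(cmod a - q) * L2_norm f \<le> L2_norm (toeplitz \<psi> f)"
      using R_le[OF f] unfolding L2_norm_scale by (simp add: algebra_simps)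
  next
    fix h assume h: "h \<in> bergman"
    interpret Metric_space bergman "\<lambda>f h. L2_norm (\<lambda>z. f z - h z)"
      by (rule bergman_Metric_space)
    define F where "F f = (\<lambda>z. inverse a * (h z - R f z))" for f
    obtain f where f: "f \<in> bergman" "F f = f"
    proof (rule Banach_fixedpoint_thm[OF bergman_mcomplete])
      show "bergman \<noteq> {}" using bergman_zero by blast
      show "F \<in> bergman \<rightarrow> bergman"
        unfolding F_def using h R_in by (intro funcsetI bergman_scale bergman_diff)
      show "q / cmod a < 1" using q a0 by (simp add: divide_less_eq)
      fix f1 f2 assume f12: "f1 \<in> bergman" "f2 \<in> bergman"
      have "L2_norm (\<lambda>z. F f1 z - F f2 z) = L2_norm (\<lambda>z. - inverse a * (R f1 z - R f2 z))"
        by (simp add: F_def algebra_simps)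
      also have "\<dots> = inverse (cmod a) * L2_norm (R (\<lambda>z. f1 z - f2 z))"
        unfolding R_diff[OF f12] by (subst L2_norm_scale) (simp add: norm_inverse)
      also have "\<dots> \<le> inverse (cmod a) * (q * L2_norm (\<lambda>z. f1 z - f2 z))"
        using f12 by (intro mult_left_mono R_le bergman_diff) auto
      finally show "L2_norm (\<lambda>z. F f1 z - F f2 z) \<le> q / cmod a * L2_norm (\<lambda>z. f1 z - f2 z)"
        by (simp add: field_simps)
    qed
    have "toeplitz \<psi> f = h"
    proof
      fix z
      have "a * f z = a * F f z" using f(2) by simp
      then show "toeplitz \<psi> f z = h z"
        using a0 by (simp add: T_eq[OF f(1)] F_def flip: mult.assoc)
    qed
    with f show "\<exists>f\<in>bergman. toeplitz \<psi> f = h" by blast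
  qed
qed

section \<open>Analytic and coanalytic symbols\<close>

text \<open>
  A lower bound for the operator does not suffice here: multiplication by the coordinate function
  has one. Surjectivity is used to write the kernel as \<open>g * h\<close>; at the point \<open>z\<close> itself this forces
  \<open>g z\<close> to be large, because \<open>h\<close> is bounded by the norm of the inverse.
\<close>
lemma toeplitz_analytic_invertible_iff:
  assumes g: "g \<in> H_infinity"
  shows "bergman_invertible (toeplitz g) \<longleftrightarrow> (\<exists>\<delta>>0. \<forall>z\<in>unit_disc. \<delta> \<le> cmod (g z))"
proof
  assume inv: "bergman_invertible (toeplitz g)"
  then obtain C where C: "C > 0" "\<And>f. f \<in> bergman \<Longrightarrow> L2_norm f \<le> C * L2_norm (toeplitz g f)"
    using bergman_invertible_bounded_below by blast
  obtain S where S: "\<And>f. f \<in> bergman \<Longrightarrow> S f \<in> bergman" "\<And>f. f \<in> bergman \<Longrightarrow> toeplitz g (S f) = f"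
    using bergman_invertible_inverse[OF inv] by metis
  have "1 / C \<le> cmod (g z)" if z: "z \<in> unit_disc" for z
  proof -
    let ?N = "L2_norm (bergman_kernel z)"
    have N: "?N > 0" by (rule bergman_kernel_norm_pos[OF z])
    have k: "bergman_kernel z \<in> bergman" by (rule bergman_kernel_bergman[OF z])
    define h where "h = S (bergman_kernel z)"
    have h: "h \<in> bergman" "toeplitz g h = bergman_kernel z"
      using S[OF k] by (auto simp: h_def)
    then have "g z * h z = bergman_kernel z z"
      using toeplitz_H_infinity[OF g h(1)] by (metis)
    then have "?N\<^sup>2 = cmod (g z) * cmod (h z)"
      unfolding bergman_kernel_diagonal[OF z] norm_mult[symmetric] by (simp add: norm_power)
    also have "\<dots> \<le> cmod (g z) * ((C * ?N) * ?N)"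
    proof (rule mult_left_mono)
      have "cmod (h z) \<le> L2_norm h * ?N" by (rule bergman_evaluation_bound[OF h(1) z])
      also have "\<dots> \<le> (C * ?N) * ?N"
        using C(2)[OF h(1)] N by (simp add: h(2))
      finally show "cmod (h z) \<le> (C * ?N) * ?N" .
    qed simp
    finally have "1 * ?N\<^sup>2 \<le> (cmod (g z) * C) * ?N\<^sup>2"
      by (simp add: power2_eq_square mult_ac)
    then have "1 \<le> cmod (g z) * C"
      using N by (simp add: mult_le_cancel_right)
    then show ?thesis
      using C(1) by (simp add: field_simps)
  qed
  with C(1) show "\<exists>\<delta>>0. \<forall>z\<in>unit_disc. \<delta> \<le> cmod (g z)"
    by (intro exI[of _ "1 / C"]) auto
next
  assume "\<exists>\<delta>>0. \<forall>z\<in>unit_disc. \<delta> \<le> cmod (g z)"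
  then obtain \<delta> where \<delta>: "\<delta> > 0" "\<And>z. z \<in> unit_disc \<Longrightarrow> \<delta> \<le> cmod (g z)" by blast
  have nz: "g z \<noteq> 0" if "z \<in> unit_disc" for z using \<delta>(1) \<delta>(2)[OF that] by auto
  let ?r = "\<lambda>z. 1 / g z"
  have r: "?r \<in> H_infinity" by (rule H_infinity_inverse[OF g \<delta>])
  obtain M where M: "bounded_symbol g M" using H_infinity_symbol[OF g] by blast
  obtain K where K: "bounded_symbol ?r K" using H_infinity_symbol[OF r] by blast
  have "toeplitz ?r (toeplitz g f) = f \<and> toeplitz g (toeplitz ?r f) = f" if f: "f \<in> bergman" for f
  proof -
    have "toeplitz (\<lambda>z. ?r z * g z) f = toeplitz (\<lambda>_. 1) f" "toeplitz (\<lambda>z. g z * ?r z) f = toeplitz (\<lambda>_. 1) f"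
      using nz f by (auto intro!: toeplitz_cong)
    then show ?thesis
      by (simp add: toeplitz_mult_analytic[OF g f] toeplitz_mult_analytic[OF r f] toeplitz_const[OF f])
  qed
  then show "bergman_invertible (toeplitz g)"
    using toeplitz_bounded_operator[OF M] toeplitz_bounded_operator[OF K] unfolding bergman_invertible_def by blast
qed

text \<open>
  Here the lower bound on the eigenvectors \<open>bergman_kernel z\<close> is enough.
\<close>
lemma toeplitz_coanalytic_invertible_iff:
  assumes g: "g \<in> H_infinity"
  shows "bergman_invertible (toeplitz (\<lambda>z. cnj (g z))) \<longleftrightarrow> (\<exists>\<delta>>0. \<forall>z\<in>unit_disc. \<delta> \<le> cmod (g z))"
proof
  assume "bergman_invertible (toeplitz (\<lambda>z. cnj (g z)))"
  then obtain C where C: "C > 0" "\<And>f. f \<in> bergman \<Longrightarrow> L2_norm f \<le> C * L2_norm (toeplitz (\<lambda>z. cnj (g z)) f)"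
    using bergman_invertible_bounded_below by blast
  have "1 / C \<le> cmod (g z)" if z: "z \<in> unit_disc" for z
  proof -
    let ?N = "L2_norm (bergman_kernel z)"
    have N: "?N > 0" by (rule bergman_kernel_norm_pos[OF z])
    have "?N \<le> C * (cmod (g z) * ?N)"
      using C(2)[OF bergman_kernel_bergman[OF z]] unfolding toeplitz_cnj_kernel[OF g z] L2_norm_scale by simp
    then have "1 * ?N \<le> (C * cmod (g z)) * ?N"
      by (simp add: mult.assoc)
    then have "1 \<le> C * cmod (g z)"
      using N by (rule mult_right_le_imp_le)
    then show ?thesis
      using C(1) by (simp add: field_simps)
  qed
  with C(1) show "\<exists>\<delta>>0. \<forall>z\<in>unit_disc. \<delta> \<le> cmod (g z)"
    by (intro exI[of _ "1 / C"]) auto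
next
  assume "\<exists>\<delta>>0. \<forall>z\<in>unit_disc. \<delta> \<le> cmod (g z)"
  then obtain \<delta> where \<delta>: "\<delta> > 0" "\<And>z. z \<in> unit_disc \<Longrightarrow> \<delta> \<le> cmod (g z)" by blast
  have nz: "g z \<noteq> 0" if "z \<in> unit_disc" for z using \<delta>(1) \<delta>(2)[OF that] by auto
  let ?r = "\<lambda>z. 1 / g z"
  have r: "?r \<in> H_infinity" by (rule H_infinity_inverse[OF g \<delta>])
  obtain M where M: "bounded_symbol (\<lambda>z. cnj (g z)) M" using H_infinity_symbol[OF g] by blast
  obtain K where K: "bounded_symbol (\<lambda>z. cnj (?r z)) K" using H_infinity_symbol[OF r] by blast
  have "toeplitz (\<lambda>z. cnj (?r z)) (toeplitz (\<lambda>z. cnj (g z)) f) = f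
      \<and> toeplitz (\<lambda>z. cnj (g z)) (toeplitz (\<lambda>z. cnj (?r z)) f) = f" if f: "f \<in> bergman" for f
  proof -
    have "toeplitz (\<lambda>z. cnj (?r z) * cnj (g z)) f = toeplitz (\<lambda>_. 1) f"
      "toeplitz (\<lambda>z. cnj (g z) * cnj (?r z)) f = toeplitz (\<lambda>_. 1) f"
      using nz f by (auto intro!: toeplitz_cong)
    then show ?thesis
      unfolding toeplitz_mult_coanalytic[OF g K f] toeplitz_mult_coanalytic[OF r M f] by (simp add: toeplitz_const[OF f])
  qed
  then show "bergman_invertible (toeplitz (\<lambda>z. cnj (g z)))"
    using toeplitz_bounded_operator[OF M] toeplitz_bounded_operator[OF K] unfolding bergman_invertible_def by blast
qed

section \<open>Coefficients of equal modulus\<close>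

text \<open>
  Test on the kernel at \<open>z\<close>, which attains the norm of evaluation at \<open>z\<close>.
\<close>
lemma multiplier_sup_le_norm:
  assumes g: "g \<in> H_infinity" and z: "z \<in> unit_disc"
    and C: "\<And>f. f \<in> bergman \<Longrightarrow> L2_norm (\<lambda>w. g w * f w) \<le> C * L2_norm f"
  shows "cmod (g z) \<le> C"
proof -
  let ?N = "L2_norm (bergman_kernel z)"
  have N: "?N > 0" by (rule bergman_kernel_norm_pos[OF z])
  have k: "bergman_kernel z \<in> bergman" by (rule bergman_kernel_bergman[OF z])
  have "cmod (g z) * ?N\<^sup>2 = cmod (g z * bergman_kernel z z)"
    unfolding bergman_kernel_diagonal[OF z] norm_mult norm_of_real by simp
  also have "\<dots> \<le> L2_norm (\<lambda>w. g w * bergman_kernel z w) * ?N"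
    by (rule bergman_evaluation_bound[OF bergman_mult_H_infinity[OF g k] z])
  also have "\<dots> \<le> (C * ?N) * ?N"
    using C[OF k] by (intro mult_right_mono) auto
  finally have "cmod (g z) * ?N\<^sup>2 \<le> C * ?N\<^sup>2"
    by (simp add: power2_eq_square mult.assoc)
  then show ?thesis
    using N by (simp add: mult_le_cancel_right)
qed

text \<open>
  Points of the frontier of the spectrum are approximate eigenvalues. If multiplication by
  \<open>g - \<mu>\<close> were bounded below by \<open>e\<close>, then division by \<open>g - \<nu>\<close> would have norm at most \<open>4 / (3 * e)\<close> for
  every \<open>\<nu>\<close> outside the closed range with \<open>dist \<mu> \<nu> < e / 4\<close>; but \<open>g\<close> comes so close to \<open>\<mu>\<close>, hence to
  \<open>\<nu>\<close>, that the supremum of \<open>1 / (g - \<nu>)\<close> is larger.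
\<close>
lemma approximate_eigenvector_at_frontier:
  assumes g: "g \<in> H_infinity" and \<mu>: "\<mu> \<in> frontier (closure (g ` unit_disc))" and e: "e > 0"
  obtains f where "f \<in> bergman" "L2_norm (\<lambda>z. (g z - \<mu>) * f z) < e * L2_norm f"
proof -
  let ?K = "closure (g ` unit_disc)"
  have "\<exists>f\<in>bergman. L2_norm (\<lambda>z. (g z - \<mu>) * f z) < e * L2_norm f"
  proof (rule ccontr)
    assume "\<not> ?thesis"
    then have below: "e * L2_norm f \<le> L2_norm (\<lambda>z. (g z - \<mu>) * f z)" if "f \<in> bergman" for f
      using that by (meson not_le)
    have "\<mu> \<in> ?K" using \<mu> by (simp add: frontier_def)
    have "e / 4 > 0" using e by simp
    then obtain \<nu> where "\<nu> \<notin> ?K" "dist \<mu> \<nu> < e / 4"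
      using \<mu> unfolding frontier_straddle by blast
    then have \<nu>: "cmod (\<nu> - \<mu>) < e / 4" "\<nu> \<notin> ?K"
      by (simp_all add: dist_norm norm_minus_commute)
    \<comment> \<open>A positive distance from \<open>\<nu>\<close> to the closed range makes \<open>1 / (g - \<nu>)\<close> bounded.\<close>
    obtain d where d: "d > 0" "\<And>w. w \<in> ?K \<Longrightarrow> d \<le> dist \<nu> w"
      using separate_point_closed[OF closed_closure \<nu>(2)] by blast
    have gK: "g z \<in> ?K" if "z \<in> unit_disc" for z
      using closure_subset[of "g ` unit_disc"] that by blast
    have "d \<le> cmod (g z - \<nu>)" if "z \<in> unit_disc" for z
      using d(2)[OF gK[OF that]] by (simp add: dist_norm norm_minus_commute)
    then have F: "(\<lambda>z. 1 / (g z - \<nu>)) \<in> H_infinity"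
      by (rule H_infinity_inverse_diff[OF g d(1)])
    have nz: "g z - \<nu> \<noteq> 0" if "z \<in> unit_disc" for z
      using gK[OF that] \<nu>(2) by auto
    have "L2_norm (\<lambda>z. 1 / (g z - \<nu>) * h z) \<le> (4 / (3 * e)) * L2_norm h" if h: "h \<in> bergman" for h
    proof -
      let ?f = "\<lambda>z. 1 / (g z - \<nu>) * h z"
      have f: "?f \<in> bergman" by (rule bergman_mult_H_infinity[OF F h])
      have "e * L2_norm ?f \<le> L2_norm (\<lambda>z. (g z - \<mu>) * ?f z)" by (rule below[OF f])
      also have "\<dots> = L2_norm (\<lambda>z. h z + (\<nu> - \<mu>) * ?f z)"
      proof (rule L2_norm_cong)
        fix z assume "z \<in> unit_disc"
        from nz[OF this] show "(g z - \<mu>) * ?f z = h z + (\<nu> - \<mu>) * ?f z"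
          by (simp add: field_simps)
      qed
      also have "\<dots> \<le> L2_norm h + L2_norm (\<lambda>z. (\<nu> - \<mu>) * ?f z)"
        by (rule L2_norm_triangle[OF bergmanD(1)[OF h] L2_scale[OF bergmanD(1)[OF f]]])
      also have "L2_norm (\<lambda>z. (\<nu> - \<mu>) * ?f z) = cmod (\<nu> - \<mu>) * L2_norm ?f"
        by (rule L2_norm_scale)
      also have "\<dots> \<le> e / 4 * L2_norm ?f"
        using \<nu>(1) by (intro mult_right_mono) auto
      finally have "3 * e * L2_norm ?f \<le> 4 * L2_norm h"
        by simp
      then show ?thesis
        using e by (simp add: field_simps)
    qed
    then have F_le: "cmod (1 / (g z - \<nu>)) \<le> 4 / (3 * e)" if "z \<in> unit_disc" for z
      by (rule multiplier_sup_le_norm[OF F that])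
    obtain z where z: "z \<in> unit_disc" "cmod (g z - \<mu>) < e / 4"
      using \<open>\<mu> \<in> ?K\<close> e closure_approachable[of \<mu> "g ` unit_disc"] by (auto simp: dist_norm dest!: spec[of _ "e / 4"])
    have "cmod (g z - \<nu>) < e / 2"
      using norm_triangle_ineq4[of "g z - \<mu>" "\<nu> - \<mu>"] z(2) \<nu>(1) by simp
    moreover have "3 * e \<le> 4 * cmod (g z - \<nu>)"
      using F_le[OF z(1)] nz[OF z(1)] e by (simp add: norm_divide field_simps)
    ultimately show False using e by linarith
  qed
  then show ?thesis using that by blast
qed

text \<open>
  For coefficients of equal modulus the real-linear map \<open>w \<mapsto> c * w + d * cnj w\<close> is degenerate. It
  vanishes on the line spanned by a square root \<open>v\<close> of the unimodular number \<open>- d / c\<close>.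
\<close>
lemma same_modulus_null_direction:
  fixes c d :: complex
  assumes cd: "cmod c = cmod d" "c \<noteq> 0"
  obtains v where "cmod v = 1" "c * v = - (d * cnj v)"
proof -
  define v where "v = csqrt (- d / c)"
  have "d \<noteq> 0" using cd by auto
  then have "cmod (- d / c) = 1" using cd by (simp add: norm_divide)
  then have n: "cmod v = 1"
    unfolding v_def by (simp add: norm_csqrt)
  have "v * v = - d / c"
    unfolding v_def by (metis power2_csqrt power2_eq_square)
  then have cvv: "c * v * v = - d"
    using cd by (simp add: field_simps)
  have "v * cnj v = 1"
    using n complex_norm_square[of v] by simp
  then have "c * v = c * v * (v * cnj v)"
    by simp
  also have "\<dots> = (c * v * v) * cnj v"
    by (simp only: mult.assoc)
  finally have "c * v = - (d * cnj v)"
    by (simp add: cvv)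
  with n show ?thesis by (rule that)
qed

text \<open>
  If the symbol comes arbitrarily close to zero, then the closed range of \<open>g\<close> meets the line on which
  \<open>c * w + d * cnj w\<close> vanishes. Moving along this line until it leaves the range gives a frontier point
  \<open>\<mu>\<close>, so some \<open>f\<close> is almost annihilated by \<open>g - \<mu>\<close>. As \<open>\<mu>\<close> lies on the line, the symbol equals
  \<open>c * (g - \<mu>) + d * cnj (g - \<mu>)\<close>, so the Toeplitz operator almost annihilates the same \<open>f\<close>.
\<close>
lemma invertible_same_modulus_imp_bounded_away:
  assumes g: "g \<in> H_infinity" and cd: "cmod c = cmod d" "c \<noteq> 0"
    and inv: "bergman_invertible (toeplitz (\<lambda>z. c * g z + d * cnj (g z)))"
  shows "\<exists>\<delta>>0. \<forall>z\<in>unit_disc. \<delta> \<le> cmod (c * g z + d * cnj (g z))"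
proof (rule ccontr)
  let ?\<phi> = "\<lambda>z. c * g z + d * cnj (g z)"
  let ?K = "closure (g ` unit_disc)"
  let ?q = "\<lambda>\<mu>. c * \<mu> + d * cnj \<mu>"
  assume no: "\<not> ?thesis"
  have "bounded (g ` unit_disc)" using g by (simp add: H_infinity_def)
  then have K: "bounded ?K" "compact ?K" by (auto simp: compact_eq_bounded_closed)
  obtain \<mu>0 where \<mu>0: "\<mu>0 \<in> ?K" "?q \<mu>0 = 0"
  proof -
    have "continuous_on ?K (\<lambda>\<mu>. cmod (?q \<mu>))" by (intro continuous_intros)
    moreover have "?K \<noteq> {}" by simp
    ultimately obtain \<mu> where \<mu>: "\<mu> \<in> ?K" "\<And>\<nu>. \<nu> \<in> ?K \<Longrightarrow> cmod (?q \<mu>) \<le> cmod (?q \<nu>)"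
      using continuous_attains_inf[OF K(2), of "\<lambda>\<mu>. cmod (?q \<mu>)"] by blast
    have "\<forall>z\<in>unit_disc. cmod (?q \<mu>) \<le> cmod (?\<phi> z)"
      using \<mu>(2) closure_subset by blast
    then have "\<not> cmod (?q \<mu>) > 0" using no by blast
    then show ?thesis using \<mu>(1) by (intro that[of \<mu>]) auto
  qed
  obtain v where v: "cmod v = 1" "c * v = - (d * cnj v)"
    using same_modulus_null_direction[OF cd] by blast
  obtain \<mu> where \<mu>: "\<mu> \<in> frontier ?K" "?q \<mu> = 0"
  proof (cases "\<mu>0 \<in> interior ?K")
    case True
    have "v \<noteq> 0" using v(1) by auto
    from ray_to_frontier[OF K(1) True this] obtain s where s: "\<mu>0 + s *\<^sub>R v \<in> frontier ?K"
      by metis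
    have "?q (\<mu>0 + s *\<^sub>R v) = ?q \<mu>0 + s * (c * v + d * cnj v)"
      by (simp add: scaleR_conv_of_real algebra_simps)
    then show ?thesis using s \<mu>0(2) v(2) by (intro that[of "\<mu>0 + s *\<^sub>R v"]) auto
  next
    case False
    then show ?thesis using \<mu>0 by (intro that[of \<mu>0]) (auto simp: frontier_def)
  qed
  obtain C where C: "C > 0" "\<And>f. f \<in> bergman \<Longrightarrow> L2_norm f \<le> C * L2_norm (toeplitz ?\<phi> f)"
    using bergman_invertible_bounded_below[OF inv] by blast
  define A where "A = cmod c + cmod d"
  have A: "A > 0" unfolding A_def using cd(2) by (intro add_pos_nonneg) auto
  obtain f where f: "f \<in> bergman" and small: "L2_norm (\<lambda>z. (g z - \<mu>) * f z) < 1 / (C * A) * L2_norm f"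
    using approximate_eigenvector_at_frontier[OF g \<mu>(1), of "1 / (C * A)"] A C(1) by auto
  obtain M where M: "bounded_symbol g M" "bounded_symbol (\<lambda>z. cnj (g z)) M" "M > 0"
    using H_infinity_symbol[OF g] by blast
  have \<phi>: "bounded_symbol ?\<phi> (A * M)"
  proof -
    have [measurable]: "g \<in> borel_measurable area" "(\<lambda>z. cnj (g z)) \<in> borel_measurable area"
      using M by (auto simp: bounded_symbol_def)
    have "cmod (?\<phi> z) \<le> A * M" if "z \<in> unit_disc" for z
    proof -
      have "cmod (?\<phi> z) \<le> cmod c * cmod (g z) + cmod d * cmod (g z)"
        using norm_triangle_ineq[of "c * g z" "d * cnj (g z)"] by (simp add: norm_mult)
      also have "\<dots> = A * cmod (g z)" by (simp add: A_def algebra_simps)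
      also have "\<dots> \<le> A * M"
        using M(1) that A by (intro mult_left_mono) (auto simp: bounded_symbol_def)
      finally show ?thesis .
    qed
    then show ?thesis by (simp add: bounded_symbol_def)
  qed
  have gm: "(\<lambda>z. g z - \<mu>) \<in> H_infinity"
    using g bounded_translation_minus[of "g ` unit_disc" \<mu>]
    by (auto simp: H_infinity_def image_image intro!: holomorphic_intros)
  have gf: "(\<lambda>z. (g z - \<mu>) * f z) \<in> L2"
    by (rule bergmanD(1)[OF bergman_mult_H_infinity[OF gm f]])
  have "L2_norm (toeplitz ?\<phi> f) \<le> L2_norm (\<lambda>z. ?\<phi> z * f z)"
    by (rule toeplitz_norm_le_mult[OF \<phi> f])
  also have "\<dots> \<le> L2_norm (\<lambda>z. of_real A * ((g z - \<mu>) * f z))"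
  proof (rule L2_norm_mono[OF bounded_symbol_mult_L2[OF \<phi> bergmanD(1)[OF f]] L2_scale[OF gf]])
    fix z
    have "?\<phi> z = c * (g z - \<mu>) + d * cnj (g z - \<mu>)"
      using \<mu>(2) by (simp add: algebra_simps)
    then have "cmod (?\<phi> z) \<le> A * cmod (g z - \<mu>)"
      using norm_triangle_ineq[of "c * (g z - \<mu>)" "d * cnj (g z - \<mu>)"]
      by (simp only: norm_mult complex_mod_cnj A_def distrib_right)
    then have "cmod (?\<phi> z) * cmod (f z) \<le> A * cmod (g z - \<mu>) * cmod (f z)"
      by (intro mult_right_mono) auto
    then show "cmod (?\<phi> z * f z) \<le> cmod (of_real A * ((g z - \<mu>) * f z))"
      using A by (simp only: norm_mult norm_of_real)
  qed
  also have "\<dots> = A * L2_norm (\<lambda>z. (g z - \<mu>) * f z)"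
    unfolding L2_norm_scale using A by simp
  finally have "L2_norm f \<le> C * (A * L2_norm (\<lambda>z. (g z - \<mu>) * f z))"
    using C(2)[OF f] C(1) by (meson less_imp_le mult_left_mono order_trans)
  moreover have "C * (A * L2_norm (\<lambda>z. (g z - \<mu>) * f z)) < L2_norm f"
    using small A C(1) by (simp add: field_simps)
  ultimately show False by simp
qed

lemma continuous_real_bounded_away_one_sided:
  fixes p :: "complex \<Rightarrow> real"
  assumes cont: "continuous_on unit_disc p" and \<delta>: "\<delta> > 0" "\<And>z. z \<in> unit_disc \<Longrightarrow> \<delta> \<le> \<bar>p z\<bar>"
  obtains \<epsilon> where "\<epsilon> = 1 \<or> \<epsilon> = -1" "\<And>z. z \<in> unit_disc \<Longrightarrow> \<delta> \<le> \<epsilon> * p z"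
proof -
  have conn: "connected (p ` unit_disc)"
    by (intro connected_continuous_image cont) simp
  have "\<not> (x \<in> unit_disc \<and> y \<in> unit_disc \<and> p x < 0 \<and> 0 < p y)" for x y
  proof
    assume xy: "x \<in> unit_disc \<and> y \<in> unit_disc \<and> p x < 0 \<and> 0 < p y"
    then have "0 \<in> p ` unit_disc"
      using connectedD_interval[OF conn, of "p x" "p y" 0] by simp
    then show False using \<delta> by force
  qed
  then have "(\<forall>z\<in>unit_disc. 0 \<le> p z) \<or> (\<forall>z\<in>unit_disc. p z \<le> 0)"
    by (meson not_le)
  then show ?thesis
  proof
    assume "\<forall>z\<in>unit_disc. 0 \<le> p z"
    then show ?thesis using \<delta>(2) by (intro that[of 1]) force+
  next
    assume "\<forall>z\<in>unit_disc. p z \<le> 0"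
    then show ?thesis using \<delta>(2) by (intro that[of "-1"]) force+
  qed
qed

text \<open>
  Up to a constant factor the symbol is a bounded real function, which keeps one sign on the disc.
  It therefore takes values in an interval away from zero, and the far end point of this interval
  is a constant to which the symbol is close enough.
\<close>
lemma bounded_away_same_modulus_imp_invertible:
  assumes g: "g \<in> H_infinity" and cd: "cmod c = cmod d" "c \<noteq> 0"
    and \<delta>: "\<delta> > 0" "\<And>z. z \<in> unit_disc \<Longrightarrow> \<delta> \<le> cmod (c * g z + d * cnj (g z))"
  shows "bergman_invertible (toeplitz (\<lambda>z. c * g z + d * cnj (g z)))"
proof -
  let ?\<phi> = "\<lambda>z. c * g z + d * cnj (g z)"
  obtain v where v: "cmod v = 1" "c * v = - (d * cnj v)"
    using same_modulus_null_direction[OF cd] by blast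
  have vv: "v * cnj v = 1" using v(1) complex_norm_square[of v] by simp
  define a where "a = 2 * \<i> * (c * v)"
  have a: "cmod a > 0" using cd(2) v(1) by (simp add: a_def norm_mult)
  define p where "p z = Im (g z * cnj v)" for z
  have \<phi>_eq: "?\<phi> z = a * of_real (p z)" for z
  proof -
    define y where "y = g z * cnj v"
    have "g z = v * y" using vv by (simp add: y_def mult_ac) 
    then have "?\<phi> z = c * v * y + (d * cnj v) * cnj y" by simp
    also have "\<dots> = c * v * (y - cnj y)" using v(2) by (simp add: algebra_simps)
    also have "y - cnj y = 2 * \<i> * of_real (Im y)" by (simp add: complex_eq_iff)
    finally show ?thesis by (simp add: a_def p_def y_def)
  qed
  have "continuous_on unit_disc p"
    unfolding p_def using g by (intro continuous_intros holomorphic_on_imp_continuous_on) (simp add: H_infinity_def)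
  moreover have "\<delta> / cmod a > 0" using \<delta>(1) a by simp
  moreover have "\<delta> / cmod a \<le> \<bar>p z\<bar>" if "z \<in> unit_disc" for z
    using \<delta>(2)[OF that] a unfolding \<phi>_eq norm_mult norm_of_real by (simp add: field_simps)
  ultimately obtain \<epsilon> where \<epsilon>: "\<epsilon> = 1 \<or> \<epsilon> = -1" "\<And>z. z \<in> unit_disc \<Longrightarrow> \<delta> / cmod a \<le> \<epsilon> * p z"
    using continuous_real_bounded_away_one_sided by blast
  obtain M where M: "bounded_symbol g M" "bounded_symbol (\<lambda>z. cnj (g z)) M" "M > 0"
    using H_infinity_symbol[OF g] by blast
  have p_le: "\<epsilon> * p z \<le> M" if "z \<in> unit_disc" for z
  proof -
    have "\<bar>p z\<bar> \<le> cmod (g z * cnj v)" unfolding p_def by (rule abs_Im_le_cmod)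
    also have "\<dots> \<le> M" using M(1) that v(1) by (simp add: norm_mult bounded_symbol_def)
    finally show ?thesis using \<epsilon>(1) by auto
  qed
  \<comment> \<open>\<open>\<epsilon> * p\<close> ranges over \<open>{\<delta> / cmod a..M}\<close>; the constant \<open>b\<close> corresponds to the end point \<open>M\<close>.\<close>
  define b where "b = a * of_real (\<epsilon> * M)"
  have b: "cmod b = cmod a * M" using \<epsilon>(1) M(3) by (auto simp: b_def norm_mult)
  have "bounded_symbol (\<lambda>z. ?\<phi> z - b) (cmod a * (M - \<delta> / cmod a))"
    unfolding bounded_symbol_def
  proof (intro conjI ballI)
    have [measurable]: "g \<in> borel_measurable area" "(\<lambda>z. cnj (g z)) \<in> borel_measurable area"
      using M by (auto simp: bounded_symbol_def)
    show "(\<lambda>z. ?\<phi> z - b) \<in> borel_measurable area" by measurable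
    fix z assume z: "z \<in> unit_disc"
    have "?\<phi> z - b = a * of_real (p z - \<epsilon> * M)"
      unfolding \<phi>_eq b_def by (simp add: algebra_simps)
    moreover have "\<bar>p z - \<epsilon> * M\<bar> \<le> M - \<delta> / cmod a"
      using \<epsilon>(1) \<epsilon>(2)[OF z] p_le[OF z] by (elim disjE) auto
    ultimately show "cmod (?\<phi> z - b) \<le> cmod a * (M - \<delta> / cmod a)"
      by (simp only: norm_mult norm_of_real) (simp add: mult_left_mono)
  qed
  moreover have "cmod a * (M - \<delta> / cmod a) < cmod b"
    using a \<delta>(1) by (simp add: b field_simps)
  ultimately show ?thesis
    by (rule toeplitz_near_constant_invertible)
qed

section \<open>Harmonic symbols built from one bounded analytic function\<close>

lemma norm_cnj_quotient_le_1:
  fixes w :: complex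
  shows "cmod (cnj w / w) \<le> 1" "cmod (w / cnj w) \<le> 1"
  by (cases "w = 0"; simp add: norm_divide)+

text \<open>
  The modulus of the symbol is between \<open>\<bar>cmod c - cmod d\<bar>\<close> and \<open>cmod c + cmod d\<close> times that of \<open>g\<close>.
\<close>
lemma bounded_away_combination_iff:
  fixes g :: "complex \<Rightarrow> complex"
  assumes "cmod c \<noteq> cmod d"
  shows "(\<exists>\<delta>>0. \<forall>z\<in>unit_disc. \<delta> \<le> cmod (c * g z + d * cnj (g z))) \<longleftrightarrow> (\<exists>\<delta>>0. \<forall>z\<in>unit_disc. \<delta> \<le> cmod (g z))"
proof -
  have upper: "cmod (c * w + d * cnj w) \<le> (cmod c + cmod d) * cmod w" for w
    using norm_triangle_ineq[of "c * w" "d * cnj w"] by (simp add: norm_mult distrib_right)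
  have lower: "\<bar>cmod c - cmod d\<bar> * cmod w \<le> cmod (c * w + d * cnj w)" for w
  proof -
    have "\<bar>cmod c - cmod d\<bar> * cmod w = \<bar>cmod (c * w) - cmod (- (d * cnj w))\<bar>"
      by (simp add: norm_mult abs_mult flip: left_diff_distrib)
    also have "\<dots> \<le> cmod (c * w - - (d * cnj w))" by (rule norm_triangle_ineq3)
    finally show ?thesis by simp
  qed
  have s: "cmod c + cmod d > 0"
    using assms norm_ge_zero[of c] norm_ge_zero[of d] by linarith
  have t: "\<bar>cmod c - cmod d\<bar> > 0" using assms by simp
  show ?thesis
  proof
    assume "\<exists>\<delta>>0. \<forall>z\<in>unit_disc. \<delta> \<le> cmod (c * g z + d * cnj (g z))"
    then obtain \<delta> where \<delta>: "\<delta> > 0" "\<forall>z\<in>unit_disc. \<delta> \<le> cmod (c * g z + d * cnj (g z))" by blast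
    have "\<delta> / (cmod c + cmod d) \<le> cmod (g z)" if "z \<in> unit_disc" for z
      using order_trans[OF bspec[OF \<delta>(2) that] upper] s by (simp add: divide_le_eq mult.commute)
    then show "\<exists>\<delta>>0. \<forall>z\<in>unit_disc. \<delta> \<le> cmod (g z)"
      using \<delta>(1) s by (intro exI[of _ "\<delta> / (cmod c + cmod d)"]) simp
  next
    assume "\<exists>\<delta>>0. \<forall>z\<in>unit_disc. \<delta> \<le> cmod (g z)"
    then obtain \<delta> where \<delta>: "\<delta> > 0" "\<forall>z\<in>unit_disc. \<delta> \<le> cmod (g z)" by blast
    have "\<bar>cmod c - cmod d\<bar> * \<delta> \<le> cmod (c * g z + d * cnj (g z))" if "z \<in> unit_disc" for z
      using mult_left_mono[OF bspec[OF \<delta>(2) that], of "\<bar>cmod c - cmod d\<bar>"] lower[of "g z"] by linarith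
    then show "\<exists>\<delta>>0. \<forall>z\<in>unit_disc. \<delta> \<le> cmod (c * g z + d * cnj (g z))"
      using \<delta>(1) t by (intro exI[of _ "\<bar>cmod c - cmod d\<bar> * \<delta>"]) simp
  qed
qed

text \<open>
  The symbol is \<open>(c + d * (cnj g / g)) * g\<close>, and the first factor differs from \<open>c\<close> by at most
  \<open>cmod d\<close>. The identity survives at zeros of \<open>g\<close>, where the quotient is zero by convention and both
  sides vanish.
\<close>
lemma toeplitz_invertible_iff_analytic_dominant:
  assumes g: "g \<in> H_infinity" and cd: "cmod d < cmod c"
  shows "bergman_invertible (toeplitz (\<lambda>z. c * g z + d * cnj (g z))) \<longleftrightarrow> bergman_invertible (toeplitz g)"
proof -
  have [measurable]: "g \<in> borel_measurable area" by (rule H_infinity_measurable[OF g])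
  have [measurable]: "(\<lambda>z. cnj (g z)) \<in> borel_measurable area" by (rule measurable_compose[OF _ cnj_measurable]) simp
  define \<psi> where "\<psi> z = c + d * (cnj (g z) / g z)" for z
  have "bounded_symbol (\<lambda>z. \<psi> z - c) (cmod d)"
    unfolding bounded_symbol_def
  proof (intro conjI ballI)
    show "(\<lambda>z. \<psi> z - c) \<in> borel_measurable area" unfolding \<psi>_def by measurable
    show "cmod (\<psi> z - c) \<le> cmod d" for z
      using mult_left_mono[OF norm_cnj_quotient_le_1(1)[of "g z"], of "cmod d"] by (simp add: \<psi>_def norm_mult del: times_divide_eq_right)
  qed
  then have \<psi>: "bergman_invertible (toeplitz \<psi>)"
    using cd by (rule toeplitz_near_constant_invertible)
  have "toeplitz (\<lambda>z. c * g z + d * cnj (g z)) f = toeplitz \<psi> (toeplitz g f)" if f: "f \<in> bergman" for f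
    unfolding toeplitz_mult_analytic[OF g f] by (rule toeplitz_cong[OF _ f]) (simp add: \<psi>_def algebra_simps)
  then have "bergman_invertible (toeplitz (\<lambda>z. c * g z + d * cnj (g z)))
      \<longleftrightarrow> bergman_invertible (\<lambda>f. toeplitz \<psi> (toeplitz g f))"
    by (rule bergman_invertible_cong)
  also have "\<dots> \<longleftrightarrow> bergman_invertible (toeplitz g)"
    by (rule bergman_invertible_comp_iff_inner[OF \<psi>])
      (simp add: toeplitz_H_infinity[OF g] bergman_mult_H_infinity[OF g])
  finally show ?thesis .
qed

text \<open>
  The symbol is \<open>cnj g * (d + c * (g / cnj g))\<close>; now the coanalytic factor has to act last.
\<close>
lemma toeplitz_invertible_iff_coanalytic_dominant:
  assumes g: "g \<in> H_infinity" and cd: "cmod c < cmod d"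
  shows "bergman_invertible (toeplitz (\<lambda>z. c * g z + d * cnj (g z))) \<longleftrightarrow> bergman_invertible (toeplitz (\<lambda>z. cnj (g z)))"
proof -
  have [measurable]: "g \<in> borel_measurable area" by (rule H_infinity_measurable[OF g])
  have [measurable]: "(\<lambda>z. cnj (g z)) \<in> borel_measurable area" by (rule measurable_compose[OF _ cnj_measurable]) simp
  define \<psi> where "\<psi> z = d + c * (g z / cnj (g z))" for z
  have near: "bounded_symbol (\<lambda>z. \<psi> z - d) (cmod c)"
    unfolding bounded_symbol_def
  proof (intro conjI ballI)
    show "(\<lambda>z. \<psi> z - d) \<in> borel_measurable area" unfolding \<psi>_def by measurable
    show "cmod (\<psi> z - d) \<le> cmod c" for z
      using mult_left_mono[OF norm_cnj_quotient_le_1(2)[of "g z"], of "cmod c"] by (simp add: \<psi>_def norm_mult del: times_divide_eq_right)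
  qed
  then have \<psi>: "bergman_invertible (toeplitz \<psi>)"
    using cd by (rule toeplitz_near_constant_invertible)
  have \<psi>b: "bounded_symbol \<psi> (cmod d + cmod c)"
    unfolding bounded_symbol_def
  proof (intro conjI ballI)
    show "\<psi> \<in> borel_measurable area" unfolding \<psi>_def by measurable
    show "cmod (\<psi> z) \<le> cmod d + cmod c" if "z \<in> unit_disc" for z
      using near that norm_triangle_ineq[of d "\<psi> z - d"] by (force simp: bounded_symbol_def)
  qed
  have "toeplitz (\<lambda>z. c * g z + d * cnj (g z)) f = toeplitz (\<lambda>z. cnj (g z)) (toeplitz \<psi> f)" if f: "f \<in> bergman" for f
    unfolding toeplitz_mult_coanalytic[OF g \<psi>b f] by (rule toeplitz_cong[OF _ f]) (simp add: \<psi>_def algebra_simps)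
  then have "bergman_invertible (toeplitz (\<lambda>z. c * g z + d * cnj (g z)))
      \<longleftrightarrow> bergman_invertible (\<lambda>f. toeplitz (\<lambda>z. cnj (g z)) (toeplitz \<psi> f))"
    by (rule bergman_invertible_cong)
  also have "\<dots> \<longleftrightarrow> bergman_invertible (toeplitz (\<lambda>z. cnj (g z)))"
    by (rule bergman_invertible_comp_iff_outer[OF \<psi>])
  finally show ?thesis .
qed

lemma toeplitz_zero_not_invertible: "\<not> bergman_invertible (toeplitz (\<lambda>_. 0))"
proof
  assume "bergman_invertible (toeplitz (\<lambda>_. 0))"
  then obtain C where C: "\<And>f. f \<in> bergman \<Longrightarrow> L2_norm f \<le> C * L2_norm (toeplitz (\<lambda>_. 0) f)"
    using bergman_invertible_bounded_below by blast
  have k: "bergman_kernel 0 \<in> bergman" by (rule bergman_kernel_bergman) simp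
  have "L2_norm (bergman_kernel 0) \<le> 0"
    using C[OF k] toeplitz_const[OF k, of 0] by (simp add: L2_norm_def)
  moreover have "L2_norm (bergman_kernel 0) > 0" by (rule bergman_kernel_norm_pos) simp
  ultimately show False by simp
qed

lemma toeplitz_combination_invertible_iff:
  assumes g: "g \<in> H_infinity"
  shows "bergman_invertible (toeplitz (\<lambda>z. c * g z + d * cnj (g z)))
    \<longleftrightarrow> (\<exists>\<delta>>0. \<forall>z\<in>unit_disc. \<delta> \<le> cmod (c * g z + d * cnj (g z)))"
proof -
  consider "c = 0" "d = 0" | "cmod c = cmod d" "c \<noteq> 0" | "cmod d < cmod c" | "cmod c < cmod d"
    by (metis linorder_less_linear norm_eq_zero)
  then show ?thesis
  proof cases
    case 1
    have "(0::complex) \<in> unit_disc" by simp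
    then have "\<not> (\<exists>\<delta>>0. \<forall>z\<in>unit_disc. \<delta> \<le> cmod (0::complex))"
      by (metis norm_zero not_le)
    with 1 show ?thesis using toeplitz_zero_not_invertible by simp
  next
    case 2
    then show ?thesis
      using invertible_same_modulus_imp_bounded_away[OF g 2] bounded_away_same_modulus_imp_invertible[OF g 2] by blast
  next
    case 3
    then show ?thesis
      using bounded_away_combination_iff[of c d g]
      by (simp add: toeplitz_invertible_iff_analytic_dominant[OF g] toeplitz_analytic_invertible_iff[OF g])
  next
    case 4
    then show ?thesis
      using bounded_away_combination_iff[of c d g]
      by (simp add: toeplitz_invertible_iff_coanalytic_dominant[OF g] toeplitz_coanalytic_invertible_iff[OF g])
  qed
qed

text \<open>
  A bounded harmonic function is its own Berezin transform: with the normalized kernel \<open>k\<close>, the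
  inner product of \<open>g k\<close> and \<open>k\<close> is \<open>g z\<close> by the reproducing property, and the conjugate part follows by
  symmetry.
\<close>
lemma berezin_combination:
  assumes g: "g \<in> H_infinity" and \<phi>: "\<forall>z\<in>unit_disc. \<phi> z = c * g z + d * cnj (g z)" and z: "z \<in> unit_disc"
  shows "berezin \<phi> z = \<phi> z"
proof -
  let ?K = "bergman_kernel z" and ?N = "L2_norm (bergman_kernel z)"
  define k where "k = normalized_kernel z"
  have K: "?K \<in> bergman" by (rule bergman_kernel_bergman[OF z])
  have N: "?N > 0" by (rule bergman_kernel_norm_pos[OF z])
  have k_eq: "k = (\<lambda>w. of_real (1 / ?N) * ?K w)"
    by (simp add: k_def normalized_kernel_def fun_eq_iff)
  have k: "k \<in> bergman" unfolding k_eq by (rule bergman_scale[OF K])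
  have gk: "L2_inner (\<lambda>w. g w * k w) k = g z"
  proof -
    have gkb: "(\<lambda>w. g w * k w) \<in> bergman" by (rule bergman_mult_H_infinity[OF g k])
    have "L2_inner (\<lambda>w. g w * k w) k = L2_inner (\<lambda>w. g w * k w) (\<lambda>w. of_real (1 / ?N) * ?K w)"
      by (simp only: k_eq)
    also have "\<dots> = of_real (1 / ?N) * L2_inner (\<lambda>w. g w * k w) ?K"
      by (simp only: L2_inner_scale_right complex_cnj_complex_of_real)
    also have "\<dots> = of_real (1 / ?N) * (g z * (of_real (1 / ?N) * of_real (?N\<^sup>2)))"
      unfolding bergman_reproducing[OF gkb z] by (simp add: k_eq bergman_kernel_diagonal[OF z])
    also have "\<dots> = g z"
      using N by (simp add: power2_eq_square)
    finally show ?thesis .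
  qed
  have gk': "L2_inner (\<lambda>w. cnj (g w) * k w) k = cnj (g z)"
    unfolding inner_cnj_mult using L2_inner_commute[of k "\<lambda>w. g w * k w"] gk by simp
  obtain M where M: "bounded_symbol g M" "bounded_symbol (\<lambda>z. cnj (g z)) M"
    using H_infinity_symbol[OF g] by blast
  note L = bounded_symbol_mult_L2[OF M(1) bergmanD(1)[OF k]] bounded_symbol_mult_L2[OF M(2) bergmanD(1)[OF k]]
  have \<phi>k: "(\<lambda>w. \<phi> w * k w) = (\<lambda>w. c * (g w * k w) + d * (cnj (g w) * k w))"
  proof
    show "\<phi> w * k w = c * (g w * k w) + d * (cnj (g w) * k w)" for w
      using \<phi> bergmanD(3)[OF k, of w] by (cases "w \<in> unit_disc") (auto simp: algebra_simps)
  qed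
  have "berezin \<phi> z = L2_inner (toeplitz \<phi> k) k"
    by (simp add: berezin_def k_def)
  also have "\<dots> = L2_inner (\<lambda>w. \<phi> w * k w) k"
    unfolding toeplitz_def by (rule bergman_proj_inner[OF _ k]) (simp only: \<phi>k L2_add L2_scale L)
  also have "\<dots> = c * g z + d * cnj (g z)"
    unfolding \<phi>k by (subst L2_inner_add_left) (simp_all add: L2_scale L bergmanD(1)[OF k] L2_inner_scale_left gk gk')
  finally show ?thesis using \<phi> z by simp
qed

theorem theorem3p5:
  fixes g \<phi> :: "complex \<Rightarrow> complex" and c d :: complex
  assumes "g \<in> H_infinity"
    and "\<forall>z\<in>unit_disc. \<phi> z = c * g z + d * cnj (g z)"
  shows "(bergman_invertible (toeplitz \<phi>) \<longleftrightarrow>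
            (\<exists>\<delta>>0. \<forall>z\<in>unit_disc. cmod (\<phi> z) \<ge> \<delta>)) \<and>
         ((\<exists>\<delta>>0. \<forall>z\<in>unit_disc. cmod (\<phi> z) \<ge> \<delta>) \<longleftrightarrow>
            (INF z\<in>unit_disc. cmod (berezin \<phi> z)) = (INF z\<in>unit_disc. cmod (\<phi> z)) \<and>
            (INF z\<in>unit_disc. cmod (\<phi> z)) > 0)"
proof (intro conjI)
  have "bergman_invertible (toeplitz \<phi>) \<longleftrightarrow> bergman_invertible (toeplitz (\<lambda>z. c * g z + d * cnj (g z)))"
    using assms(2) by (intro bergman_invertible_cong toeplitz_cong) auto
  then show "bergman_invertible (toeplitz \<phi>) \<longleftrightarrow> (\<exists>\<delta>>0. \<forall>z\<in>unit_disc. cmod (\<phi> z) \<ge> \<delta>)"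
    using assms(2) by (simp add: toeplitz_combination_invertible_iff[OF assms(1)])
next
  have ber: "(INF z\<in>unit_disc. cmod (berezin \<phi> z)) = (INF z\<in>unit_disc. cmod (\<phi> z))"
    using berezin_combination[OF assms] by (intro INF_cong) auto
  have bdd: "bdd_below ((\<lambda>z. cmod (\<phi> z)) ` unit_disc)"
    by (rule bdd_belowI2[of _ 0]) simp
  have "(\<exists>\<delta>>0. \<forall>z\<in>unit_disc. \<delta> \<le> cmod (\<phi> z)) \<longleftrightarrow> (INF z\<in>unit_disc. cmod (\<phi> z)) > 0"
  proof
    assume "\<exists>\<delta>>0. \<forall>z\<in>unit_disc. \<delta> \<le> cmod (\<phi> z)"
    then obtain \<delta> where \<delta>: "\<delta> > 0" "\<And>z. z \<in> unit_disc \<Longrightarrow> \<delta> \<le> cmod (\<phi> z)" by blast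
    have "\<delta> \<le> (INF z\<in>unit_disc. cmod (\<phi> z))"
      using \<delta>(2) by (intro cINF_greatest) auto
    with \<delta>(1) show "(INF z\<in>unit_disc. cmod (\<phi> z)) > 0" by simp
  next
    assume "(INF z\<in>unit_disc. cmod (\<phi> z)) > 0"
    then show "\<exists>\<delta>>0. \<forall>z\<in>unit_disc. \<delta> \<le> cmod (\<phi> z)"
      using cINF_lower[OF bdd] by blast
  qed
  with ber show "(\<exists>\<delta>>0. \<forall>z\<in>unit_disc. cmod (\<phi> z) \<ge> \<delta>) \<longleftrightarrow>
      (INF z\<in>unit_disc. cmod (berezin \<phi> z)) = (INF z\<in>unit_disc. cmod (\<phi> z)) \<and>
      (INF z\<in>unit_disc. cmod (\<phi> z)) > 0"
    by simp
qed

end
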